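(* Let $\alpha_2\approx 0.2797707433$ be the root in $[0,1]$ of $8\alpha^4-8\alpha^3+8\alpha^2=1/2$. For every $\alpha\in[\alpha_2,1/3]$, the map $G_\alpha$ admits an absolutely continuous invariant probability measure (with respect to two-dimensional Lebesgue measure on $[0,1]^2$).
   Context: Let $\tau:[0,1]\to[0,1]$ be the symmetric tent map, $\tau(x)=2x$ for $0\le x<1/2$ and $\tau(x)=2-2x$ for $1/2\le x\le 1$. For $0<\alpha<1$ define $G_\alpha:[0,1]^2\to[0,1]^2$ by $G_\alpha(x,y)=(y,\tau(\alpha y+(1-\alpha)x))$. *)

theory Defs
  imports "HOL-Probability.Probability"
begin

text \<open>Symmetric tent map (values outside [0,1] are irrelevant).\<close>
definition tent :: "real \<Rightarrow> real" where
  "tent x = (if x < 1/2 then 2 * x else 2 - 2 * x)"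

definition G :: "real \<Rightarrow> real \<times> real \<Rightarrow> real \<times> real" where
  "G \<alpha> p = (snd p, tent (\<alpha> * snd p + (1 - \<alpha>) * fst p))"

definition alpha2 :: real where
  "alpha2 = (THE a. 0 \<le> a \<and> a \<le> 1 \<and> 8 * a^4 - 8 * a^3 + 8 * a^2 = 1/2)"

definition has_acip :: "(real \<times> real \<Rightarrow> real \<times> real) \<Rightarrow> bool" where
  "has_acip T \<longleftrightarrow> (\<exists>\<mu> :: (real \<times> real) measure.
      sets \<mu> = sets borel \<and> prob_space \<mu> \<and>
      emeasure \<mu> ({0..1} \<times> {0..1}) = 1 \<and>
      absolutely_continuous lborel \<mu> \<and>
      T \<in> measurable \<mu> \<mu> \<and>
      (\<forall>A \<in> sets \<mu>. emeasure \<mu> (T -` A \<inter> space \<mu>) = emeasure \<mu> A))"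

end

theory Submission
  imports Defs
begin

text \<open>
  Both branches of \<open>G \<alpha>\<close> are affine and multiply area by \<open>d = 2 (1 - \<alpha>) > 1\<close>. It suffices to show that
  the push-forwards of Lebesgue measure from a suitable convex set have densities bounded uniformly in
  the number of steps; a cluster point of their Cesaro averages is then the required measure.

  The density after \<open>n\<close> steps is at most \<open>d\<^sup>-\<^sup>n\<close> times the number of convex pieces of the \<open>n\<close>-th image, so
  one has to bound this number by \<open>C d\<^sup>n\<close>. Pieces are kept of small diameter and of two kinds. Fat ones, of area
  at least \<open>\<eta>\<close>, are few since the total area is at most \<open>d\<^sup>n\<close>. A thin one is, under a fixed
  iterate \<open>G\<^sup>N\<close>, cut into at most \<open>O(\<Lambda>) + 2 K\<close> pieces, where \<open>\<Lambda>\<close> bounds the expansion and \<open>K\<close> counts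
  the \<open>N\<close>-cylinders meeting a small set: \<open>K\<close> enters additively because at most two cylinders can run
  lengthwise along a thin strip. Finally \<open>K = O(1.32\<^sup>N)\<close>, since an orbit can hit the fold at most
  twice in five steps on average, and \<open>\<Lambda> = O(0.995\<^sup>N d\<^sup>N)\<close>, since the condition \<open>\<alpha> \<ge> \<alpha>\<^sub>2\<close> excludes
  three consecutive visits to the left branch; and \<open>1.32 < 4/3 \<le> d\<close>.
\<close>

section \<open>Area in the plane\<close>

text \<open>The two singular values of the linear part of \<open>G^N\<close> on a cylinder multiply
  to \<open>d^N\<close>, so a bound \<open>o(d^N)\<close> on the largest says that the smallest
  tends to infinity: it is uniform expansion in disguise. This is not automatic, as the left branch
  has an eigenvalue of modulus below 1 once \<alpha> > 1/4. Slicing a piece finely enough for its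
  images to stay small costs about \<open>\<Lambda>\<close> slices, hence \<open>o(d^N)\<close>; the
  obstacle is that slices times cylinders, about \<open>\<Lambda> K\<close>, is not
  \<open>o(d^N)\<close> by these estimates, since 0.995 * 1.32 > 1. The equation for \<alpha>_2
  comes from the corner (1,0). One right step and two left steps send it through (0, 2\<alpha>) and
  (2\<alpha>, 4\<alpha>^2) to a point whose average is 8\<alpha>^4 - 8\<alpha>^3 + 8\<alpha>^2, and
  the value 1/2 puts that point on the fold. The bound \<alpha> \<le> 1/3 gives d \<ge> 4/3,
  narrowly above 2^(2/5) = 1.3195..., the growth rate of two doublings in five steps.\<close>

lemma emeasure_lborel_prod:
  fixes S :: "(real \<times> real) set"
  assumes "S \<in> sets borel"
  shows "emeasure lborel S = (\<integral>\<^sup>+x. \<integral>\<^sup>+y. indicator S (x, y) \<partial>lborel \<partial>lborel)"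
proof -
  have "S \<in> sets (lborel \<Otimes>\<^sub>M lborel)" using assms unfolding lborel_prod by simp
  then have "emeasure (lborel \<Otimes>\<^sub>M lborel) S = (\<integral>\<^sup>+x. \<integral>\<^sup>+y. indicator S (x, y) \<partial>lborel \<partial>lborel)"
    by (rule lborel.emeasure_pair_measure)
  then show ?thesis by (simp add: lborel_prod)
qed

lemma nn_integral_lborel_swap:
  fixes f :: "real \<times> real \<Rightarrow> ennreal"
  assumes "f \<in> borel_measurable borel"
  shows "(\<integral>\<^sup>+x. \<integral>\<^sup>+y. f (x, y) \<partial>lborel \<partial>lborel) = (\<integral>\<^sup>+y. \<integral>\<^sup>+x. f (x, y) \<partial>lborel \<partial>lborel)"
proof -
  have f: "f \<in> borel_measurable (lborel \<Otimes>\<^sub>M lborel)" using assms by (simp add: lborel_prod)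
  have fs: "(\<lambda>(x, y). f (y, x)) \<in> borel_measurable (lborel \<Otimes>\<^sub>M lborel)" using f by measurable
  show ?thesis
    using lborel_pair.Fubini[OF f] by simp
qed

lemma measurable_affine_pair:
  "(\<lambda>p. (a * fst p + b * snd p + e, c * fst p + f * snd p + g)) \<in> borel_measurable borel"
  for a b c e f g :: real
  by (intro borel_measurable_continuous_onI continuous_intros)

text \<open>For \<open>a \<noteq> 0\<close> the map splits into one-dimensional substitutions, first
  in x for fixed y, then in y for fixed x, with Fubini in between. The remaining case is reduced to
  this one by swapping the coordinates.\<close>

lemma emeasure_affine_vimage_aux:
  fixes a b c f e g :: real and E :: "(real \<times> real) set"
  assumes E: "E \<in> sets borel" and det: "a * f - b * c \<noteq> 0" and a: "a \<noteq> 0"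
  defines "L \<equiv> (\<lambda>p. (a * fst p + b * snd p + e, c * fst p + f * snd p + g))"
  shows "ennreal \<bar>a * f - b * c\<bar> * emeasure lborel (L -` E) = emeasure lborel E"
proof -
  let ?I = "\<lambda>p. indicator E p :: ennreal"
  have meas[measurable]: "?I \<in> borel_measurable borel" using E by measurable
  have Lm: "L \<in> borel_measurable borel" unfolding L_def by (rule measurable_affine_pair)
  have LE: "L -` E \<in> sets borel" using measurable_sets[OF Lm E] by simp
  have mL: "(\<lambda>p. ?I (L p)) \<in> borel_measurable borel"
    by (rule measurable_compose[OF Lm meas])
  \<comment> \<open>The slope in y of the second coordinate once the first coordinate of
    \<open>L\<close> has been made the variable; \<open>a * m\<close> is the determinant.\<close>
  define m where "m = f - b * c / a"
  have am: "a * m = a * f - b * c" using a by (simp add: m_def field_simps)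
  have m0: "m \<noteq> 0" using am det by auto
  have "emeasure lborel (L -` E) = (\<integral>\<^sup>+x. \<integral>\<^sup>+y. ?I (L (x, y)) \<partial>lborel \<partial>lborel)"
    by (subst emeasure_lborel_prod[OF LE]) (simp add: indicator_def)
  also have "\<dots> = (\<integral>\<^sup>+y. \<integral>\<^sup>+x. ?I (L (x, y)) \<partial>lborel \<partial>lborel)"
    by (rule nn_integral_lborel_swap[OF mL])
  finally have 1: "emeasure lborel (L -` E) = \<dots>" .
  have inner: "\<bar>a\<bar> * (\<integral>\<^sup>+x. ?I (L (x, y)) \<partial>lborel) = (\<integral>\<^sup>+x. ?I (x, m * y + (g + c * (x - e) / a)) \<partial>lborel)" for y
  proof -
    have mm: "(\<lambda>x. ?I (x, m * y + (g + c * (x - e) / a))) \<in> borel_measurable borel"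
    proof (rule measurable_compose[OF _ meas])
      show "(\<lambda>x. (x, m * y + (g + c * (x - e) / a))) \<in> borel_measurable borel"
        using a by (intro borel_measurable_continuous_onI continuous_intros) auto
    qed
    have "L (x, y) = ((b * y + e) + a * x, m * y + (g + c * (((b * y + e) + a * x) - e) / a))" for x
      using a by (simp add: L_def m_def field_simps)
    then show ?thesis
      using nn_integral_real_affine[OF mm a, of "b * y + e"] by simp
  qed
  have mK: "(\<lambda>p. ?I (snd p, m * fst p + (g + c * (snd p - e) / a))) \<in> borel_measurable borel"
  proof (rule measurable_compose[OF _ meas])
    show "(\<lambda>p. (snd p, m * fst p + (g + c * (snd p - e) / a))) \<in> borel_measurable borel"
      using a by (intro borel_measurable_continuous_onI continuous_intros) auto
  qed
  have mJ: "(\<lambda>y. \<integral>\<^sup>+x. ?I (L (x, y)) \<partial>lborel) \<in> borel_measurable lborel"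
  proof (rule lborel.borel_measurable_nn_integral)
    have "(\<lambda>(y, x). ?I (L (x, y))) \<in> borel_measurable (borel :: (real \<times> real) measure)"
    proof -
      have "(\<lambda>p. L (snd p, fst p)) \<in> borel_measurable borel" unfolding L_def
        by (intro borel_measurable_continuous_onI continuous_intros)
      from measurable_compose[OF this meas] show ?thesis by (simp add: case_prod_beta')
    qed
    then show "(\<lambda>(y, x). ?I (L (x, y))) \<in> borel_measurable (lborel \<Otimes>\<^sub>M lborel)" by (simp add: lborel_prod)
  qed
  have "\<bar>a\<bar> * emeasure lborel (L -` E) = (\<integral>\<^sup>+y. \<bar>a\<bar> * (\<integral>\<^sup>+x. ?I (L (x, y)) \<partial>lborel) \<partial>lborel)"
    unfolding 1 using mJ by (subst nn_integral_cmult) auto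
  also have "\<dots> = (\<integral>\<^sup>+y. (\<integral>\<^sup>+x. ?I (x, m * y + (g + c * (x - e) / a)) \<partial>lborel) \<partial>lborel)"
    by (simp only: inner)
  also have "\<dots> = (\<integral>\<^sup>+x. (\<integral>\<^sup>+y. ?I (x, m * y + (g + c * (x - e) / a)) \<partial>lborel) \<partial>lborel)"
    using nn_integral_lborel_swap[OF mK] by simp
  finally have 2: "\<bar>a\<bar> * emeasure lborel (L -` E) = \<dots>" .
  have inner2: "\<bar>m\<bar> * (\<integral>\<^sup>+y. ?I (x, m * y + (g + c * (x - e) / a)) \<partial>lborel) = (\<integral>\<^sup>+y. ?I (x, y) \<partial>lborel)" for x
  proof -
    have mm: "(\<lambda>y. ?I (x, y)) \<in> borel_measurable borel"
      by (rule measurable_compose[OF _ meas]) (intro borel_measurable_continuous_onI continuous_intros)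
    show ?thesis using nn_integral_real_affine[OF mm m0, of "g + c * (x - e) / a"] by (simp add: algebra_simps)
  qed
  have mJ2: "(\<lambda>x. \<integral>\<^sup>+y. ?I (x, m * y + (g + c * (x - e) / a)) \<partial>lborel) \<in> borel_measurable lborel"
  proof (rule lborel.borel_measurable_nn_integral)
    have "(\<lambda>(x, y). ?I (x, m * y + (g + c * (x - e) / a))) \<in> borel_measurable (borel :: (real \<times> real) measure)"
    proof -
      have "(\<lambda>p. (fst p, m * snd p + (g + c * (fst p - e) / a))) \<in> borel_measurable borel"
        using a by (intro borel_measurable_continuous_onI continuous_intros) auto
      from measurable_compose[OF this meas] show ?thesis by (simp add: case_prod_beta')
    qed
    then show "(\<lambda>(x, y). ?I (x, m * y + (g + c * (x - e) / a))) \<in> borel_measurable (lborel \<Otimes>\<^sub>M lborel)"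
      by (simp add: lborel_prod)
  qed
  have "\<bar>m\<bar> * (\<bar>a\<bar> * emeasure lborel (L -` E)) = (\<integral>\<^sup>+x. \<bar>m\<bar> * (\<integral>\<^sup>+y. ?I (x, m * y + (g + c * (x - e) / a)) \<partial>lborel) \<partial>lborel)"
    unfolding 2 using mJ2 by (subst nn_integral_cmult) auto
  also have "\<dots> = emeasure lborel E"
    by (simp only: inner2 emeasure_lborel_prod[OF E])
  finally have "\<bar>m\<bar> * (\<bar>a\<bar> * emeasure lborel (L -` E)) = emeasure lborel E" .
  moreover have "ennreal \<bar>a * f - b * c\<bar> = ennreal \<bar>m\<bar> * ennreal \<bar>a\<bar>"
    using am by (simp flip: ennreal_mult abs_mult add: mult.commute)
  ultimately show ?thesis by (simp add: mult.assoc)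
qed

lemma emeasure_swap_vimage:
  fixes E :: "(real \<times> real) set"
  assumes E: "E \<in> sets borel"
  shows "emeasure lborel (prod.swap -` E) = emeasure lborel E"
proof -
  have m: "prod.swap \<in> borel_measurable (borel :: (real \<times> real) measure)"
    unfolding prod.swap_def by (intro borel_measurable_continuous_onI continuous_intros)
  have s: "prod.swap -` E \<in> sets borel" using measurable_sets[OF m E] by simp
  have "(indicator E :: _ \<Rightarrow> ennreal) \<in> borel_measurable borel" using E by measurable
  from nn_integral_lborel_swap[OF this] show ?thesis
    by (simp add: emeasure_lborel_prod[OF s] emeasure_lborel_prod[OF E] indicator_def)
qed

lemma emeasure_affine_vimage:
  fixes a b c f e g :: real and E :: "(real \<times> real) set"
  assumes E: "E \<in> sets borel" and det: "a * f - b * c \<noteq> 0"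
  shows "ennreal \<bar>a * f - b * c\<bar> * emeasure lborel ((\<lambda>p. (a * fst p + b * snd p + e, c * fst p + f * snd p + g)) -` E)
     = emeasure lborel E"
proof (cases "a = 0")
  case False
  then show ?thesis using emeasure_affine_vimage_aux[OF E det] by blast
next
  case True
  let ?L = "\<lambda>p. (a * fst p + b * snd p + e, c * fst p + f * snd p + g)"
  let ?K = "\<lambda>p. (b * fst p + a * snd p + e, f * fst p + c * snd p + g)"
  have b: "b \<noteq> 0" and d2: "b * c - a * f \<noteq> 0" using det True by auto
  have eq: "prod.swap -` (?L -` E) = ?K -` E" by (auto simp: add.commute)
  have "?L -` E \<in> sets borel" using measurable_sets[OF measurable_affine_pair E] by simp
  from emeasure_swap_vimage[OF this] have "emeasure lborel (?L -` E) = emeasure lborel (?K -` E)"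
    using eq by simp
  moreover have "\<bar>a * f - b * c\<bar> = \<bar>b * c - a * f\<bar>" by (rule abs_minus_commute)
  ultimately show ?thesis using emeasure_affine_vimage_aux[OF E d2 b] by simp
qed

lemma measure_affine_vimage:
  fixes a b c f e g :: real and E :: "(real \<times> real) set"
  assumes E: "E \<in> sets borel" and det: "a * f - b * c \<noteq> 0"
  shows "\<bar>a * f - b * c\<bar> * measure lborel ((\<lambda>p. (a * fst p + b * snd p + e, c * fst p + f * snd p + g)) -` E)
     = measure lborel E"
  using arg_cong[OF emeasure_affine_vimage[OF E det, of e g], of enn2real]
  by (simp add: enn2real_mult measure_def)

lemma lborel_square: "emeasure lborel ({a..b} \<times> {c..d}) = ennreal ((b - a) * (d - c))"
  if "a \<le> b" "c \<le> d" for a b c d :: real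
proof -
  have "emeasure lborel ({a..b} \<times> {c..d}) = emeasure lborel {a..b} * emeasure lborel {c..d}"
    by (subst lborel_prod[symmetric]) (rule lborel.emeasure_pair_measure_Times; simp)
  with that show ?thesis by (simp add: ennreal_mult)
qed

lemma measure_lborel_square: "measure lborel ({a..b} \<times> {c..d}) = (b - a) * (d - c)"
  if "a \<le> b" "c \<le> d" for a b c d :: real
  using lborel_square[OF that] that by (simp add: measure_def)

text \<open>\<open>P\<close> contains the triangle pqr, and this contains the parallelogram at p
  with sides half of pq and pr, which is an affine image of a square. Its area is a quarter of the
  determinant, hence the factor 4. The lemma bounds the width of a convex set of small area.\<close>

lemma convex_measure_triangle:
  fixes P :: "(real \<times> real) set"
  assumes P: "convex P" "P \<in> sets borel" "emeasure lborel P < \<infinity>" and pqr: "p \<in> P" "q \<in> P" "r \<in> P"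
  shows "\<bar>(fst q - fst p) * (snd r - snd p) - (snd q - snd p) * (fst r - fst p)\<bar> \<le> 4 * measure lborel P"
proof (cases "(fst q - fst p) * (snd r - snd p) - (fst r - fst p) * (snd q - snd p) = 0")
  case True
  then show ?thesis by (simp add: mult.commute)
next
  case False
  define a b c f where "a = fst q - fst p" "b = fst r - fst p" "c = snd q - snd p" "f = snd r - snd p"
  note defs = this
  let ?L = "\<lambda>t. (a * fst t + b * snd t + fst p, c * fst t + f * snd t + snd p)"
  let ?Q = "{0..1/2::real} \<times> {0..1/2::real}"
  have det: "a * f - b * c \<noteq> 0" using False by (simp add: defs)
  have Q: "?Q = cbox (0,0) (1/2,1/2)" by (simp add: cbox_Pair_eq)
  have "compact (?L ` ?Q)" unfolding Q
    by (intro compact_continuous_image continuous_intros compact_cbox)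
  then have Lb: "?L ` ?Q \<in> sets borel" by (simp add: borel_closed compact_imp_closed)
  have inj: "inj ?L"
  proof (rule injI)
    fix s t assume e: "?L s = ?L t"
    then have 1: "a * (fst s - fst t) + b * (snd s - snd t) = 0"
      and 2: "c * (fst s - fst t) + f * (snd s - snd t) = 0" by (auto simp: algebra_simps)
    have "(a * f - b * c) * (fst s - fst t) = f * (a * (fst s - fst t) + b * (snd s - snd t)) - b * (c * (fst s - fst t) + f * (snd s - snd t))"
      and "(a * f - b * c) * (snd s - snd t) = a * (c * (fst s - fst t) + f * (snd s - snd t)) - c * (a * (fst s - fst t) + b * (snd s - snd t))"
      by (simp_all add: algebra_simps)
    then have "fst s = fst t" "snd s = snd t" using 1 2 det by auto
    then show "s = t" by (simp add: prod_eq_iff)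
  qed
  have vi: "?L -` (?L ` ?Q) = ?Q" by (rule inj_vimage_image_eq[OF inj])
  have sub: "?L ` ?Q \<subseteq> P"
  proof clarify
    fix s t :: real assume st: "s \<in> {0..1/2}" "t \<in> {0..1/2}"
    have "convex hull {p, q, r} \<subseteq> P" using P(1) pqr by (intro hull_minimal) auto
    moreover have "(1 - s - t) *\<^sub>R p + s *\<^sub>R q + t *\<^sub>R r \<in> convex hull {p, q, r}"
      using st unfolding convex_hull_3 by fastforce
    ultimately have "(1 - s - t) *\<^sub>R p + s *\<^sub>R q + t *\<^sub>R r \<in> P" by blast
    moreover have "(1 - s - t) *\<^sub>R p + s *\<^sub>R q + t *\<^sub>R r = ?L (s, t)"
      by (simp add: prod_eq_iff defs algebra_simps)
    ultimately show "?L (s, t) \<in> P" by simp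
  qed
  have "\<bar>a * f - b * c\<bar> * (1/4) = measure lborel (?L ` ?Q)"
    using measure_affine_vimage[OF Lb det, of "fst p" "snd p"] measure_lborel_square[of 0 "1/2" 0 "1/2"]
    unfolding vi by simp
  also have "\<dots> \<le> measure lborel P"
    using P sub Lb by (intro measure_mono_fmeasurable) (auto simp: fmeasurable_def)
  finally show ?thesis by (simp add: defs mult.commute)
qed

section \<open>Itineraries and expansion\<close>

definition qf :: "real \<Rightarrow> real \<Rightarrow> real \<Rightarrow> real \<times> real \<Rightarrow> real" where
  "qf p r q v = p * (fst v)\<^sup>2 + 2 * r * fst v * snd v + q * (snd v)\<^sup>2"

lemma qf_nonneg:
  assumes "0 < p" "r\<^sup>2 \<le> p * q"
  shows "0 \<le> qf p r q v"
proof -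
  have "p * qf p r q v = (p * fst v + r * snd v)\<^sup>2 + (p * q - r\<^sup>2) * (snd v)\<^sup>2"
    by (simp add: qf_def power2_eq_square algebra_simps)
  also have "\<dots> \<ge> 0" using assms by simp
  finally show ?thesis using assms(1) by (simp add: zero_le_mult_iff)
qed

lemma qf_scale: "c * qf p r q v = qf (c * p) (c * r) (c * q) v"
  by (simp add: qf_def algebra_simps)

lemma qf_add: "qf p r q v + qf p' r' q' v = qf (p + p') (r + r') (q + q') v"
  by (simp add: qf_def algebra_simps)

text \<open>The hypotheses say that the Bernstein coefficients on \<open>[l, u]\<close> of a form depending
  quadratically on the parameter \<open>t\<close> are positive semidefinite.\<close>
lemma qf_bernstein:
  fixes l u t :: real
  assumes t: "l \<le> t" "t \<le> u" "l < u"
    and 0: "0 < p0 + p1 * l + p2 * l\<^sup>2"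
      "(r0 + r1 * l + r2 * l\<^sup>2)\<^sup>2 \<le> (p0 + p1 * l + p2 * l\<^sup>2) * (q0 + q1 * l + q2 * l\<^sup>2)"
    and 1: "0 < p0 + p1 * ((l + u) / 2) + p2 * (l * u)"
      "(r0 + r1 * ((l + u) / 2) + r2 * (l * u))\<^sup>2
         \<le> (p0 + p1 * ((l + u) / 2) + p2 * (l * u)) * (q0 + q1 * ((l + u) / 2) + q2 * (l * u))"
    and 2: "0 < p0 + p1 * u + p2 * u\<^sup>2"
      "(r0 + r1 * u + r2 * u\<^sup>2)\<^sup>2 \<le> (p0 + p1 * u + p2 * u\<^sup>2) * (q0 + q1 * u + q2 * u\<^sup>2)"
  shows "0 \<le> qf (p0 + p1 * t + p2 * t\<^sup>2) (r0 + r1 * t + r2 * t\<^sup>2) (q0 + q1 * t + q2 * t\<^sup>2) v"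
proof -
  have bern: "(u - l)\<^sup>2 * (c0 + c1 * t + c2 * t\<^sup>2) = (u - t)\<^sup>2 * (c0 + c1 * l + c2 * l\<^sup>2)
    + 2 * ((u - t) * (t - l)) * (c0 + c1 * ((l + u) / 2) + c2 * (l * u))
    + (t - l)\<^sup>2 * (c0 + c1 * u + c2 * u\<^sup>2)" for c0 c1 c2
    by (simp add: power2_eq_square field_simps)
  have "(u - l)\<^sup>2 * qf (p0 + p1 * t + p2 * t\<^sup>2) (r0 + r1 * t + r2 * t\<^sup>2) (q0 + q1 * t + q2 * t\<^sup>2) v
    = (u - t)\<^sup>2 * qf (p0 + p1 * l + p2 * l\<^sup>2) (r0 + r1 * l + r2 * l\<^sup>2) (q0 + q1 * l + q2 * l\<^sup>2) v
    + 2 * ((u - t) * (t - l)) * qf (p0 + p1 * ((l + u) / 2) + p2 * (l * u))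
        (r0 + r1 * ((l + u) / 2) + r2 * (l * u)) (q0 + q1 * ((l + u) / 2) + q2 * (l * u)) v
    + (t - l)\<^sup>2 * qf (p0 + p1 * u + p2 * u\<^sup>2) (r0 + r1 * u + r2 * u\<^sup>2) (q0 + q1 * u + q2 * u\<^sup>2) v"
    by (simp add: qf_scale bern qf_add)
  also have "\<dots> \<ge> 0"
    using t by (intro add_nonneg_nonneg mult_nonneg_nonneg qf_nonneg 0 1 2) auto
  finally show ?thesis using t(3) by (simp add: zero_le_mult_iff)
qed

section \<open>The two affine branches, itineraries and cylinders\<close>

locale tent_memory =
  fixes a :: real
  assumes a_lo: "279/1000 \<le> a" and a_hi: "a \<le> 1/3"
    and a_poly: "1/2 \<le> 8 * a^4 - 8 * a^3 + 8 * a\<^sup>2"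
begin

definition d :: real where "d = 2 - 2 * a"

lemma d_bounds: "4/3 \<le> d" "d \<le> 2"
  using a_lo a_hi by (auto simp: d_def)

definition avg :: "real \<times> real \<Rightarrow> real" where "avg p = a * snd p + (1 - a) * fst p"

definition right :: "real \<times> real \<Rightarrow> bool" where "right p \<longleftrightarrow> 1/2 \<le> avg p"

definition sq :: "(real \<times> real) set" where "sq = {0..1} \<times> {0..1}"

definition Br :: "bool \<Rightarrow> real \<times> real \<Rightarrow> real \<times> real" where
  "Br b p = (snd p, if b then 2 - 2 * avg p else 2 * avg p)"

definition Lin :: "bool \<Rightarrow> real \<times> real \<Rightarrow> real \<times> real" where
  "Lin b v = (snd v, if b then - 2 * avg v else 2 * avg v)"

primrec itin :: "nat \<Rightarrow> real \<times> real \<Rightarrow> bool list" where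
  "itin 0 p = []"
| "itin (Suc n) p = right p # itin n (G a p)"

text \<open>The branches are composed as affine maps of the whole plane, whatever the itinerary of
  the point, so injectivity and the area factor hold globally. Agreement with the iterate of
  \<open>G a\<close> is claimed only along the point's own itinerary.\<close>

primrec Brw :: "bool list \<Rightarrow> real \<times> real \<Rightarrow> real \<times> real" where
  "Brw [] p = p"
| "Brw (b # w) p = Brw w (Br b p)"

primrec Linw :: "bool list \<Rightarrow> real \<times> real \<Rightarrow> real \<times> real" where
  "Linw [] p = p"
| "Linw (b # w) p = Linw w (Lin b p)"

lemma G_Br: "G a p = Br (right p) p"
  by (auto simp: G_def Br_def right_def avg_def tent_def)

lemma length_itin [simp]: "length (itin n p) = n"
  by (induction n arbitrary: p) auto

lemma Brw_itin: "Brw (itin n p) p = (G a ^^ n) p"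
  by (induction n arbitrary: p) (auto simp: G_Br funpow_swap1)

lemma Brw_diff: "Brw w p - Brw w q = Linw w (p - q)"
proof (induction w arbitrary: p q)
  case (Cons b w)
  have "Br b p - Br b q = Lin b (p - q)" by (auto simp: Br_def Lin_def avg_def algebra_simps)
  with Cons show ?case by simp
qed simp

lemma Br_convex: "Br b ((1 - u) *\<^sub>R p + u *\<^sub>R q) = (1 - u) *\<^sub>R Br b p + u *\<^sub>R Br b q"
  by (auto simp: Br_def avg_def algebra_simps)

lemma Brw_convex: "Brw w ((1 - u) *\<^sub>R p + u *\<^sub>R q) = (1 - u) *\<^sub>R Brw w p + u *\<^sub>R Brw w q"
  by (induction w arbitrary: p q) (auto simp: Br_convex)

lemma convex_Brw_image: "convex P \<Longrightarrow> convex (Brw w ` P)"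
  unfolding convex_alt by (fastforce simp flip: Brw_convex)

lemma Br_measurable [measurable]: "Br b \<in> borel_measurable borel"
  unfolding Br_def avg_def by (cases b) (auto intro!: borel_measurable_continuous_onI continuous_intros)

lemma Brw_measurable [measurable]: "Brw w \<in> borel_measurable borel"
  by (induction w) (auto intro: measurable_compose[OF Br_measurable])

lemma right_measurable [measurable]: "Measurable.pred borel right"
  unfolding right_def avg_def borel_prod[symmetric] by measurable

lemma G_measurable [measurable]: "G a \<in> borel_measurable borel"
proof -
  have "G a = (\<lambda>p. if right p then Br True p else Br False p)" by (auto simp: G_Br)
  then show ?thesis by simp
qed

lemma Gn_measurable [measurable]: "(G a ^^ n) \<in> borel_measurable borel"
  by (induction n) (auto intro: measurable_comp[OF _ G_measurable] simp: id_def)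

definition cyl :: "bool list \<Rightarrow> (real \<times> real) set" where
  "cyl w = {p. itin (length w) p = w}"

lemma cyl_Nil: "cyl [] = UNIV" by (auto simp: cyl_def)

lemma cyl_Cons: "cyl (b # w) = {p. right p = b} \<inter> Br b -` cyl w"
  by (auto simp: cyl_def G_Br)

lemma cyl_borel [measurable]: "cyl w \<in> sets borel"
proof (induction w)
  case (Cons b w)
  then have "Br b -` cyl w \<in> sets borel" using measurable_sets[OF Br_measurable, of "cyl w" b] by simp
  moreover have "{p. right p = b} \<in> sets borel" by (cases b) auto
  ultimately show ?case unfolding cyl_Cons by blast
qed (simp add: cyl_Nil)

lemma cyl_convex: "convex (cyl w)"
proof (induction w)
  case (Cons b w)
  have avg: "avg p = (a *\<^sub>R (0,1) + (1 - a) *\<^sub>R (1,0)) \<bullet> p" for p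
    by (simp add: avg_def inner_prod_def algebra_simps)
  have "{p. right p = b} = {p. avg p \<ge> 1/2} \<or> {p. right p = b} = {p. avg p < 1/2}"
    by (cases b) (auto simp: right_def)
  then have "convex {p. right p = b}"
    unfolding avg by (metis convex_halfspace_ge convex_halfspace_lt)
  moreover have "convex (Br b -` cyl w)"
    using Cons unfolding convex_alt by (simp add: Br_convex)
  ultimately show ?case unfolding cyl_Cons by (rule convex_Int)
qed (simp add: cyl_Nil)

lemma measure_Brw_vimage:
  assumes "E \<in> sets borel"
  shows "d ^ length w * measure lborel (Brw w -` E) = measure lborel E"
  using assms
proof (induction w)
  case (Cons b w)
  have B: "Brw w -` E \<in> sets borel" using measurable_sets[OF Brw_measurable Cons.prems] by simp
  have *: "d * measure lborel (Br b -` E') = measure lborel E'" if "E' \<in> sets borel" for E'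
  proof (cases b)
    case True
    have "Br b = (\<lambda>p. (0 * fst p + 1 * snd p + 0, (- d) * fst p + (- 2 * a) * snd p + 2))"
      using True by (auto simp: Br_def avg_def d_def algebra_simps)
    then show ?thesis using measure_affine_vimage[OF that, of 0 "- 2 * a" 1 "- d" 0 2] d_bounds by simp
  next
    case False
    have "Br b = (\<lambda>p. (0 * fst p + 1 * snd p + 0, d * fst p + (2 * a) * snd p + 0))"
      using False by (auto simp: Br_def avg_def d_def algebra_simps)
    then show ?thesis using measure_affine_vimage[OF that, of 0 "2 * a" 1 d 0 0] d_bounds by simp
  qed
  have "Brw (b # w) -` E = Br b -` (Brw w -` E)" by auto
  moreover have "d ^ length (b # w) * measure lborel (Br b -` (Brw w -` E)) = d ^ length w * (d * measure lborel (Br b -` (Brw w -` E)))"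
    by simp
  ultimately show ?case using *[OF B] Cons.IH[OF Cons.prems] by (metis)
qed (simp add: vimage_def)

lemma inj_Brw: "inj (Brw w)"
proof (induction w)
  case (Cons b w)
  have "inj (Br b)"
    using a_hi by (intro injI) (auto simp: Br_def avg_def prod_eq_iff split: if_splits)
  with Cons have "inj (Brw w \<circ> Br b)" by (rule inj_compose)
  then show ?case by (simp add: inj_def)
qed (simp add: inj_def)

lemma Br_image_borel:
  assumes "P \<in> sets borel" shows "Br b ` P \<in> sets borel"
proof -
  define I where "I = (\<lambda>p. (((if b then 2 - snd p else snd p) / 2 - a * fst p) / (1 - a), fst p))"
  have m: "I \<in> borel_measurable borel"
    unfolding I_def using a_hi by (cases b) (auto intro!: borel_measurable_continuous_onI continuous_intros)
  have i: "I (Br b p) = p" for p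
    using a_hi by (auto simp: I_def Br_def avg_def prod_eq_iff field_simps)
  have j: "Br b (I p) = p" for p
    using a_hi by (auto simp: I_def Br_def avg_def prod_eq_iff field_simps)
  have "Br b ` P = I -` P" 
    using i j by (auto simp: image_iff) (metis)
  then show ?thesis using measurable_sets[OF m assms] by simp
qed

lemma Brw_image_borel:
  "P \<in> sets borel \<Longrightarrow> Brw w ` P \<in> sets borel"
proof (induction w arbitrary: P)
  case (Cons b w)
  have "Brw (b # w) ` P = Brw w ` (Br b ` P)" by (auto simp: image_image)
  then show ?case using Cons Br_image_borel by simp
qed simp

section \<open>Returns to the right branch and the region \<open>U\<close>\<close>

lemma avg_sq: "p \<in> sq \<Longrightarrow> 0 \<le> avg p \<and> avg p \<le> 1"
  using a_lo a_hi convex_bound_le[of "snd p" 1 "fst p" a "1 - a"]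
  by (auto simp: avg_def sq_def mem_Times_iff)

lemma G_sq: "p \<in> sq \<Longrightarrow> G a p \<in> sq"
  using avg_sq[of p] by (auto simp: G_Br Br_def sq_def right_def mem_Times_iff)

lemma Gn_sq: "p \<in> sq \<Longrightarrow> (G a ^^ n) p \<in> sq"
  by (induction n) (auto simp: G_sq)

text \<open>If the first two images are on the left, the average at the third is an affine function
  of \<open>y\<close> and \<open>v\<close>, increasing in \<open>v\<close>. It is least for
  \<open>v = 2 * a * (1 - y)\<close> and \<open>y = 0\<close>, that is at the corner (1,0), where it
  equals the polynomial in \<open>a_poly\<close>.\<close>

lemma right_return:
  assumes p: "p \<in> sq" and s: "right p"
  shows "right (G a p) \<or> right (G a (G a p)) \<or> right (G a (G a (G a p)))"
proof (rule ccontr)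
  assume n: "\<not> ?thesis"
  define y v where "y = snd p" and "v = 2 - 2 * avg p"
  have G1: "G a p = (y, v)" using s by (simp add: G_Br Br_def y_def v_def)
  define w where "w = 2 * (a * v + (1 - a) * y)"
  have G2: "G a (G a p) = (v, w)" using n unfolding G1 by (simp add: G_Br Br_def avg_def w_def)
  define t where "t = 2 * (a * w + (1 - a) * v)"
  have G3: "G a (G a (G a p)) = (w, t)" using n unfolding G2 by (simp add: G_Br Br_def avg_def t_def)
  have y: "0 \<le> y" "y \<le> 1" and x: "fst p \<le> 1" using p by (auto simp: sq_def y_def mem_Times_iff)
  have "avg p \<le> a * y + (1 - a)" using x a_hi by (simp add: avg_def y_def mult_left_le)
  then have v: "2 * a * (1 - y) \<le> v" by (simp add: v_def algebra_simps)
  have "1/2 \<le> 8 * a^4 - 8 * a^3 + 8 * a\<^sup>2" by (rule a_poly)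
  \<comment> \<open>The factor of \<open>y\<close> is the slope of the third average along
    \<open>v = 2 * a * (1 - y)\<close>; it is at least 16/27 - 4/9 > 0.\<close>
  also have "\<dots> \<le> 8 * a^4 - 8 * a^3 + 8 * a\<^sup>2 + y * ((2*a\<^sup>2 + 1 - a) * (2 * (1 - a) - 4 * a\<^sup>2) - 4 * a\<^sup>2 * (1 - a))"
  proof -
    have a2: "a\<^sup>2 \<le> 1/9" using power_mono[of a "1/3" 2] a_lo a_hi by (simp add: power2_eq_square)
    have "2/3 * (8/9) \<le> (2*a\<^sup>2 + 1 - a) * (2 * (1 - a) - 4 * a\<^sup>2)"
    proof (intro mult_mono)
      show "2/3 \<le> 2*a\<^sup>2 + 1 - a" using a_hi zero_le_power2[of a] by linarith
      then show "0 \<le> 2*a\<^sup>2 + 1 - a" by linarith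
    qed (use a2 a_hi in auto)
    moreover have "4 * a\<^sup>2 * (1 - a) \<le> 4 * (1/9) * 1" using a2 a_lo a_hi by (intro mult_mono) auto
    ultimately have "0 \<le> (2*a\<^sup>2 + 1 - a) * (2 * (1 - a) - 4 * a\<^sup>2) - 4 * a\<^sup>2 * (1 - a)" by linarith
    then show ?thesis using mult_nonneg_nonneg[OF y(1)] by fastforce
  qed
  also have "\<dots> = (2*a\<^sup>2 + 1 - a) * (2 * a * (2 * a * (1 - y)) + 2 * (1 - a) * y) + 2 * a * (1 - a) * (2 * a * (1 - y))"
    by (simp add: power2_eq_square power3_eq_cube power4_eq_xxxx algebra_simps)
  also have "\<dots> \<le> (2*a\<^sup>2 + 1 - a) * (2 * a * v + 2 * (1 - a) * y) + 2 * a * (1 - a) * v"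
  proof -
    have "0 \<le> 2*a\<^sup>2 + 1 - a" using a_hi zero_le_power2[of a] by linarith
    then show ?thesis using v a_lo a_hi by (intro add_mono mult_left_mono order_refl) auto
  qed
  also have "\<dots> = a * t + (1 - a) * w"
    by (simp add: t_def w_def power2_eq_square algebra_simps)
  finally have "right (G a (G a (G a p)))" unfolding G3 by (simp add: right_def avg_def)
  with n show False by blast
qed

text \<open>The forward invariant region where no three consecutive symbols are \<open>False\<close>; there the iterates expand
  in all directions, although the \<open>False\<close> branch alone is a saddle.\<close>
definition U :: "(real \<times> real) set" where
  "U = {p \<in> sq. \<forall>n. right ((G a ^^ n) p) \<or> right ((G a ^^ Suc n) p) \<or> right ((G a ^^ Suc (Suc n)) p)}"

lemma U_sq: "U \<subseteq> sq" by (auto simp: U_def)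

lemma G_U: "p \<in> U \<Longrightarrow> G a p \<in> U"
proof -
  assume p: "p \<in> U"
  have "right ((G a ^^ n) (G a p)) \<or> right ((G a ^^ Suc n) (G a p)) \<or> right ((G a ^^ Suc (Suc n)) (G a p))" for n
    using p unfolding U_def by (auto simp: funpow_swap1 dest!: spec[of _ "Suc n"])
  with p show ?thesis by (simp add: U_def G_sq)
qed

lemma Gn_U: "p \<in> U \<Longrightarrow> (G a ^^ n) p \<in> U"
  by (induction n) (auto simp: G_U)

lemma right_U: assumes "p \<in> sq" "right p" shows "p \<in> U"
proof -
  have "right ((G a ^^ n) p) \<or> right ((G a ^^ Suc n) p) \<or> right ((G a ^^ Suc (Suc n)) p)" for n
  proof (induction n)
    case (Suc n)
    then show ?case using right_return[OF Gn_sq[OF assms(1)], of n] by auto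
  qed (use assms in simp)
  with assms show ?thesis by (auto simp: U_def)
qed

text \<open>The difference of the two sides is again a quadratic form in \<open>v\<close>. Its
  coefficients are sorted by powers of \<open>a\<close>, the shape that \<open>qf_bernstein\<close>
  needs to settle all parameters of the interval at once.\<close>

lemma qf_Lin:
  defines "k \<equiv> 99/100"
  assumes "\<sigma> = (if b then -1 else 1)"
    and "\<And>v. 0 \<le> qf (4 * (k*p - q') + (-8 * (k*p - q')) * a + 4 * (k*p - q') * a\<^sup>2)
      ((4*k*r - 2*\<sigma>*r') + (2*\<sigma>*r' - 8*k*r - 4*q') * a + (4*k*r + 4*q') * a\<^sup>2)
      ((4*k*q - p') + (-8*k*q - 4*\<sigma>*r') * a + (4*k*q - 4*q') * a\<^sup>2) v"
  shows "qf p' r' q' (Lin b v) \<le> 99/100 * d\<^sup>2 * qf p r q v"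
proof -
  have "99/100 * d\<^sup>2 * qf p r q v - qf p' r' q' (Lin b v) = 
    qf (4 * (k*p - q') + (-8 * (k*p - q')) * a + 4 * (k*p - q') * a\<^sup>2)
      ((4*k*r - 2*\<sigma>*r') + (2*\<sigma>*r' - 8*k*r - 4*q') * a + (4*k*r + 4*q') * a\<^sup>2)
      ((4*k*q - p') + (-8*k*q - 4*\<sigma>*r') * a + (4*k*q - 4*q') * a\<^sup>2) v"
    unfolding qf_def Lin_def avg_def d_def assms(2) k_def
    by (cases b; simp add: power2_eq_square algebra_simps)
  with assms(3)[of v] show ?thesis by simp
qed

text \<open>The forms were found by numerical optimisation. The case distinction is on whether the preceding
  symbol is \<open>True\<close> and on the number (at most 2) of \<open>False\<close> symbols ahead.\<close>
definition form :: "bool \<Rightarrow> real \<times> real \<Rightarrow> real \<times> real \<Rightarrow> real" where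
  "form prev p = (if right p then (if prev then qf 174 38 100 else qf 158 (-10) 115)
    else if right (G a p) then (if prev then qf 137 47 118 else qf 141 38 120)
    else qf 133 83 145)"

text \<open>One inequality for each edge of the transition graph between the five states of
  \<open>form\<close>. Each of the two \<open>True\<close> states leads to the three states preceded
  by \<open>True\<close>; each \<open>False\<close> state has a single successor.\<close>

lemma Lin_edges:
  "qf 174 38 100 (Lin True v) \<le> 99/100 * d\<^sup>2 * qf 174 38 100 v"
  "qf 137 47 118 (Lin True v) \<le> 99/100 * d\<^sup>2 * qf 174 38 100 v"
  "qf 133 83 145 (Lin True v) \<le> 99/100 * d\<^sup>2 * qf 174 38 100 v"
  "qf 174 38 100 (Lin True v) \<le> 99/100 * d\<^sup>2 * qf 158 (-10) 115 v"
  "qf 137 47 118 (Lin True v) \<le> 99/100 * d\<^sup>2 * qf 158 (-10) 115 v"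
  "qf 133 83 145 (Lin True v) \<le> 99/100 * d\<^sup>2 * qf 158 (-10) 115 v"
  "qf 158 (-10) 115 (Lin False v) \<le> 99/100 * d\<^sup>2 * qf 137 47 118 v"
  "qf 141 38 120 (Lin False v) \<le> 99/100 * d\<^sup>2 * qf 133 83 145 v"
  "qf 158 (-10) 115 (Lin False v) \<le> 99/100 * d\<^sup>2 * qf 141 38 120 v"
  by (rule qf_Lin[OF refl], rule qf_bernstein[OF a_lo a_hi]; simp add: power2_eq_square)+

text \<open>The forms act as a Lyapunov function along the itinerary. The second hypothesis excludes
  a \<open>False\<close> symbol followed by two more, for which \<open>form\<close> is not designed;
  within \<open>U\<close> it passes to the next point.\<close>

lemma Linw_growth:
  assumes "p \<in> U" "prev \<or> right p \<or> right (G a p)"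
  shows "(fst (Linw (itin n p) v))\<^sup>2 + (snd (Linw (itin n p) v))\<^sup>2 \<le> (99/100 * d\<^sup>2) ^ n * form prev p v"
  using assms
proof (induction n arbitrary: p prev v)
  case 0
  \<comment> \<open>Each of the five forms minus the Euclidean one is still positive
    semidefinite.\<close>
  have "0 \<le> qf 173 38 99 v" "0 \<le> qf 157 (-10) 114 v" "0 \<le> qf 136 47 117 v" "0 \<le> qf 140 38 119 v" "0 \<le> qf 132 83 144 v"
    by (rule qf_nonneg; simp)+
  then show ?case by (auto simp: form_def qf_def)
next
  case (Suc n)
  have U3: "right p \<or> right (G a p) \<or> right (G a (G a p))" using Suc.prems(1) by (auto simp: U_def dest: spec[of _ 0])
  have edge: "form (right p) (G a p) (Lin (right p) v) \<le> 99/100 * d\<^sup>2 * form prev p v"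
    using Suc.prems(2) U3 Lin_edges[of v] by (auto simp: form_def)
  have "(fst (Linw (itin n (G a p)) (Lin (right p) v)))\<^sup>2 + (snd (Linw (itin n (G a p)) (Lin (right p) v)))\<^sup>2
      \<le> (99/100 * d\<^sup>2) ^ n * form (right p) (G a p) (Lin (right p) v)"
    by (rule Suc.IH[OF G_U[OF Suc.prems(1)] U3])
  also have "\<dots> \<le> (99/100 * d\<^sup>2) ^ n * (99/100 * d\<^sup>2 * form prev p v)"
    by (rule mult_left_mono[OF edge]) simp
  finally show ?case by (simp add: mult_ac)
qed

lemma form_le: "form prev p v \<le> 300 * ((fst v)\<^sup>2 + (snd v)\<^sup>2)"
proof -
  have "0 \<le> qf (300-174) (-38) 200 v" "0 \<le> qf (300-158) 10 (300-115) v" "0 \<le> qf (300-137) (-47) (300-118) v"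
     "0 \<le> qf (300-141) (-38) (300-120) v" "0 \<le> qf (300-133) (-83) (300-145) v"
    by (rule qf_nonneg; simp)+
  then show ?thesis by (auto simp: form_def qf_def algebra_simps)
qed

text \<open>The square root of the growth bound for squared lengths. Two coordinates of size e and
  \<open>form_le\<close> give 2 * 300 e^2, rounded up to 625 e^2 = (25 e)^2.\<close>

definition Lam :: "nat \<Rightarrow> real" where "Lam n = 25 * sqrt (99/100) ^ n * d ^ n"

lemma Brw_itin_lipschitz:
  assumes "p \<in> U" and v: "\<bar>fst r - fst s\<bar> \<le> e" "\<bar>snd r - snd s\<bar> \<le> e"
  shows "\<bar>fst (Brw (itin n p) r) - fst (Brw (itin n p) s)\<bar> \<le> Lam n * e"
    and "\<bar>snd (Brw (itin n p) r) - snd (Brw (itin n p) s)\<bar> \<le> Lam n * e"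
proof -
  let ?v = "r - s" let ?V = "Linw (itin n p) ?v"
  have e: "0 \<le> e" using v(1) by linarith
  have L: "0 \<le> Lam n" using d_bounds by (simp add: Lam_def)
  have "(fst ?V)\<^sup>2 + (snd ?V)\<^sup>2 \<le> (99/100 * d\<^sup>2) ^ n * form True p ?v"
    by (rule Linw_growth[OF assms(1)]) simp
  also have "\<dots> \<le> (99/100 * d\<^sup>2) ^ n * (300 * ((fst ?v)\<^sup>2 + (snd ?v)\<^sup>2))"
    by (intro mult_left_mono form_le) simp
  also have "\<dots> \<le> (99/100 * d\<^sup>2) ^ n * (300 * (e\<^sup>2 + e\<^sup>2))"
    using v by (intro mult_left_mono add_mono) (auto simp: abs_le_square_iff[symmetric])
  also have "\<dots> \<le> (99/100 * d\<^sup>2) ^ n * (625 * e\<^sup>2)"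
    by (intro mult_left_mono) auto
  also have "\<dots> = (Lam n * e)\<^sup>2"
  proof -
    have "(sqrt (99/100) ^ n)\<^sup>2 = (99/100) ^ n" by (simp flip: power_mult add: mult.commute[of n] power_mult)
    moreover have "(d ^ n)\<^sup>2 = (d\<^sup>2) ^ n" by (simp flip: power_mult add: mult.commute)
    ultimately show ?thesis by (simp only: Lam_def power_mult_distrib) simp
  qed
  finally have *: "(fst ?V)\<^sup>2 + (snd ?V)\<^sup>2 \<le> (Lam n * e)\<^sup>2" .
  have "\<bar>fst ?V\<bar> \<le> \<bar>Lam n * e\<bar>" "\<bar>snd ?V\<bar> \<le> \<bar>Lam n * e\<bar>"
    unfolding abs_le_square_iff using * by (smt (verit) zero_le_power2)+
  then show "\<bar>fst (Brw (itin n p) r) - fst (Brw (itin n p) s)\<bar> \<le> Lam n * e"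
    "\<bar>snd (Brw (itin n p) r) - snd (Brw (itin n p) s)\<bar> \<le> Lam n * e"
    using L e by (simp_all flip: Brw_diff)
qed

end

section \<open>Thin strips and the number of cylinders\<close>

lemma affine_ivt:
  fixes f :: "'a::real_vector \<Rightarrow> real"
  assumes "convex D" "X \<in> D" "Y \<in> D"
    and aff: "\<And>x y t. f ((1 - t) *\<^sub>R x + t *\<^sub>R y) = (1 - t) * f x + t * f y"
    and k: "f X \<le> k" "k \<le> f Y"
  obtains t where "0 \<le> t" "t \<le> 1" "(1 - t) *\<^sub>R X + t *\<^sub>R Y \<in> D" "f ((1 - t) *\<^sub>R X + t *\<^sub>R Y) = k"
    "t * (f Y - f X) = k - f X"
proof (cases "f X = f Y")
  case True
  then show ?thesis using that[of 0] assms by simp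
next
  case False
  define t where "t = (k - f X) / (f Y - f X)"
  have t: "0 \<le> t" "t \<le> 1" "t * (f Y - f X) = k - f X" using k False by (auto simp: t_def divide_simps)
  moreover have "f ((1 - t) *\<^sub>R X + t *\<^sub>R Y) = k" unfolding aff using t(3) by (simp add: algebra_simps)
  ultimately show ?thesis using that assms(1-3) by (simp add: convexD_alt)
qed

text \<open>The segment AB meets the line u = m at height at most \<open>w\<close>. The segment to C
  from whichever of A, B lies across that line covers at least a fraction \<tau> of its length
  before meeting it, so it has reached height at least -w + \<tau> \<rho> \<ge> w there. Between
  these two points of D lies one of height exactly w. That point depends only on m and w, so two
  disjoint sets cannot both satisfy the hypotheses.\<close>

lemma strip_crossing:
  fixes u h :: "'a::real_vector \<Rightarrow> real"
  assumes D: "convex D" "A \<in> D" "B \<in> D" "C \<in> D"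
    and u: "\<And>x y t. u ((1 - t) *\<^sub>R x + t *\<^sub>R y) = (1 - t) * u x + t * u y"
    and h: "\<And>x y t. h ((1 - t) *\<^sub>R x + t *\<^sub>R y) = (1 - t) * h x + t * h y"
    and AB: "0 \<le> u A" "u A \<le> m - \<tau>" "m + \<tau> \<le> u B" "u B \<le> 1" "\<bar>h A\<bar> \<le> w" "\<bar>h B\<bar> \<le> w"
    and C: "\<rho> \<le> h C" "0 \<le> u C" "u C \<le> 1"
    and \<tau>: "0 < \<tau>" "2 * w \<le> \<tau> * \<rho>" and \<rho>: "0 \<le> \<rho>"
  shows "\<exists>Z\<in>D. u Z = m \<and> h Z = w"
proof -
  have w: "0 \<le> w" using AB(5) by linarith
  obtain t where t: "0 \<le> t" "t \<le> 1" and M: "(1 - t) *\<^sub>R A + t *\<^sub>R B \<in> D" "u ((1 - t) *\<^sub>R A + t *\<^sub>R B) = m"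
  proof -
    have "u A \<le> m" "m \<le> u B" using AB \<tau> by linarith+
    then show ?thesis using affine_ivt[OF D(1,2,3) u] that by blast
  qed
  define M where "M = (1 - t) *\<^sub>R A + t *\<^sub>R B"
  have "h M \<le> (1 - t) * w + t * w" unfolding M_def h
    using t AB by (intro add_mono mult_left_mono) auto
  then have hM: "h M \<le> w" by (simp add: algebra_simps)
  \<comment> \<open>Here \<open>y\<close> stands for \<open>h A\<close> or
    \<open>h B\<close>.\<close>
  have far: "w \<le> (1 - t) * y + t * h C" if "\<bar>y\<bar> \<le> w" "\<tau> \<le> t" "t \<le> 1" for t y
  proof -
    have "- w + \<tau> * \<rho> \<le> (1 - t) * (- w) + t * \<rho>"
    proof -
      have "\<tau> * \<rho> \<le> t * \<rho>" "0 \<le> t * w" using that w \<tau>(1) \<rho> by (auto intro: mult_right_mono)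
      then show ?thesis by (simp add: algebra_simps)
    qed
    also have "\<dots> \<le> (1 - t) * y + t * h C" using that \<tau>(1) C by (intro add_mono mult_left_mono) auto
    finally show ?thesis using \<tau> by linarith
  qed
  have "\<exists>T\<in>D. u T = m \<and> w \<le> h T"
  proof (cases "m \<le> u C")
    case True
    obtain t where t: "0 \<le> t" "t \<le> 1" "(1 - t) *\<^sub>R A + t *\<^sub>R C \<in> D" "u ((1 - t) *\<^sub>R A + t *\<^sub>R C) = m"
      "t * (u C - u A) = m - u A"
    proof -
      have "u A \<le> m" using AB \<tau> by linarith
      then show ?thesis using affine_ivt[OF D(1,2,4) u _ True] that by blast
    qed
    have "\<tau> \<le> m - u A" using AB by linarith
    also have "\<dots> \<le> t * 1" unfolding t(5)[symmetric] using t AB C by (intro mult_left_mono) auto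
    finally have "w \<le> (1 - t) * h A + t * h C" using far[of "h A" t] AB t by simp
    then show ?thesis using t h by (intro bexI[of _ "(1 - t) *\<^sub>R A + t *\<^sub>R C"]) auto
  next
    case False
    have u': "- u ((1 - t) *\<^sub>R x + t *\<^sub>R y) = (1 - t) * (- u x) + t * (- u y)" for x y t
      unfolding u by (simp add: algebra_simps)
    have "- u B \<le> - m" "- m \<le> - u C" using AB \<tau> False by auto
    then obtain t where t: "0 \<le> t" "t \<le> 1" "(1 - t) *\<^sub>R B + t *\<^sub>R C \<in> D" "- u ((1 - t) *\<^sub>R B + t *\<^sub>R C) = - m"
      "t * (- u C - (- u B)) = - m - (- u B)"
      by (rule affine_ivt[OF D(1,3,4) u'])
    have "\<tau> \<le> - m - (- u B)" using AB by linarith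
    also have "\<dots> \<le> t * 1" unfolding t(5)[symmetric] using t AB C by (intro mult_left_mono) auto
    finally have "w \<le> (1 - t) * h B + t * h C" using far[of "h B" t] AB t by simp
    then show ?thesis using t h by (intro bexI[of _ "(1 - t) *\<^sub>R B + t *\<^sub>R C"]) auto
  qed
  then obtain T where T: "T \<in> D" "u T = m" "w \<le> h T" by blast
  have MD: "M \<in> D" "u M = m" using M by (auto simp: M_def)
  obtain t where "(1 - t) *\<^sub>R M + t *\<^sub>R T \<in> D" "h ((1 - t) *\<^sub>R M + t *\<^sub>R T) = w"
    using affine_ivt[OF D(1) MD(1) T(1) h hM T(3)] by blast
  moreover have "u ((1 - t) *\<^sub>R M + t *\<^sub>R T) = m" unfolding u MD T by (simp add: algebra_simps)
  ultimately show ?thesis by blast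
qed

text \<open>A thin strip \<open>P\<close> is sliced by the coordinate \<open>u\<close>. If the pieces of two disjoint convex sets
  both extend over a slice on each side, the sets leave the strip on opposite sides there; so at most two
  of them do, and the number of (set, slice) pairs is additive rather than multiplicative.\<close>
lemma strip_count:
  fixes u h :: "'a::real_vector \<Rightarrow> real"
  assumes fin: "finite W" and D: "\<And>w. w \<in> W \<Longrightarrow> convex (D w)"
    and disj: "\<And>w w'. w \<in> W \<Longrightarrow> w' \<in> W \<Longrightarrow> w \<noteq> w' \<Longrightarrow> D w \<inter> D w' = {}"
    and u: "\<And>x y t. u ((1 - t) *\<^sub>R x + t *\<^sub>R y) = (1 - t) * u x + t * u y"
    and h: "\<And>x y t. h ((1 - t) *\<^sub>R x + t *\<^sub>R y) = (1 - t) * h x + t * h y"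
    and inj: "\<And>x y. u x = u y \<Longrightarrow> h x = h y \<Longrightarrow> x = y"
    and P: "\<And>r. r \<in> P \<Longrightarrow> \<bar>h r\<bar> \<le> \<omega> \<and> 0 \<le> u r \<and> u r \<le> 1"
    and far: "\<And>w. w \<in> W \<Longrightarrow> \<exists>C\<in>D w. \<rho> \<le> \<bar>h C\<bar> \<and> 0 \<le> u C \<and> u C \<le> 1"
    and \<sigma>: "0 < \<sigma>" "4 * \<omega> \<le> \<sigma> * \<rho>" and \<rho>: "0 \<le> \<rho>"
    and K: "finite K" "\<And>r. r \<in> P \<Longrightarrow> \<lfloor>u r / \<sigma>\<rfloor> \<in> K"
  defines "I \<equiv> {(w, k). w \<in> W \<and> (\<exists>r\<in>P \<inter> D w. \<lfloor>u r / \<sigma>\<rfloor> = k)}"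
  shows "finite I" "card I \<le> 2 * card K + 2 * card W"
proof -
  have IWK: "I \<subseteq> W \<times> K" using K by (auto simp: I_def)
  then show finI: "finite I" using fin K finite_subset by blast
  \<comment> \<open>For each set its lowest and its highest slice are charged to
    \<open>card W\<close>. In the slices of \<open>mid\<close> the set continues on both sides;
    these are charged to \<open>card K\<close>, once for exits at the top and once for exits at the
    bottom.\<close>
  define lo where "lo = {(w, k) \<in> I. \<forall>k'. (w, k') \<in> I \<longrightarrow> k \<le> k'}"
  define hi where "hi = {(w, k) \<in> I. \<forall>k'. (w, k') \<in> I \<longrightarrow> k' \<le> k}"
  define mid where "mid = I - lo - hi"
  define ps where "ps = {(w, k) \<in> mid. \<exists>C\<in>D w. \<rho> \<le> h C \<and> 0 \<le> u C \<and> u C \<le> 1}"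
  define ng where "ng = {(w, k) \<in> mid. \<exists>C\<in>D w. \<rho> \<le> - h C \<and> 0 \<le> u C \<and> u C \<le> 1}"
  have sub: "I \<subseteq> lo \<union> hi \<union> (ps \<union> ng)"
  proof clarify
    fix w k assume I: "(w, k) \<in> I" "(w, k) \<notin> ng" "(w, k) \<notin> ps" "(w, k) \<notin> hi"
    show "(w, k) \<in> lo"
    proof (rule ccontr)
      assume "(w, k) \<notin> lo"
      with I have "(w, k) \<in> mid" by (simp add: mid_def)
      moreover obtain C where "C \<in> D w" "\<rho> \<le> \<bar>h C\<bar>" "0 \<le> u C" "u C \<le> 1" using far I(1) by (auto simp: I_def)
      ultimately show False using I unfolding ps_def ng_def by (cases "0 \<le> h C") auto
    qed
  qed
  have midE: "\<exists>A\<in>P \<inter> D w. \<exists>B\<in>P \<inter> D w. u A \<le> (k + 1/2) * \<sigma> - \<sigma>/2 \<and> (k + 1/2) * \<sigma> + \<sigma>/2 \<le> u B"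
    if mid: "(w, k) \<in> mid" for w k
  proof -
    have "(w, k) \<in> I" "(w, k) \<notin> lo" "(w, k) \<notin> hi" using mid by (auto simp: mid_def)
    then obtain k1 k2 where k: "(w, k1) \<in> I" "k1 < k" "(w, k2) \<in> I" "k < k2" by (auto simp: lo_def hi_def not_le)
    then obtain A B where AB: "A \<in> P \<inter> D w" "B \<in> P \<inter> D w" "\<lfloor>u A / \<sigma>\<rfloor> = k1" "\<lfloor>u B / \<sigma>\<rfloor> = k2" by (auto simp: I_def)
    have "u A / \<sigma> < k" using AB(3) k(2) by linarith
    moreover have "k + 1 \<le> u B / \<sigma>" using AB(4) k(4) by linarith
    ultimately have "u A \<le> k * \<sigma>" "(k + 1) * \<sigma> \<le> u B" using \<sigma>(1) by (auto simp: field_simps)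
    with AB show ?thesis by (intro bexI[of _ A] bexI[of _ B]) (auto simp: algebra_simps)
  qed
  \<comment> \<open>Both sets would contain the point of height \<omega> on the middle line of slice
    k. Taking \<open>g\<close> as \<open>h\<close> or its negative treats the two sides
    together.\<close>
  have uniq: "w = w'" if "(w, k) \<in> mid" "(w', k) \<in> mid" "C \<in> D w" "C' \<in> D w'"
    "\<rho> \<le> g C" "0 \<le> u C" "u C \<le> 1" "\<rho> \<le> g C'" "0 \<le> u C'" "u C' \<le> 1" "g = h \<or> g = (\<lambda>x. - h x)" for w w' k C C' g
  proof -
    have g: "g ((1 - t) *\<^sub>R x + t *\<^sub>R y) = (1 - t) * g x + t * g y" for x y t
      using that(11) h by (auto simp: algebra_simps)
    have W: "w \<in> W" "w' \<in> W" using that IWK by (auto simp: mid_def)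
    have *: "\<exists>Z\<in>D w. u Z = (k + 1/2) * \<sigma> \<and> g Z = \<omega>"
      if mid: "(w, k) \<in> mid" and C: "C \<in> D w" "\<rho> \<le> g C" "0 \<le> u C" "u C \<le> 1" for w C
    proof -
      obtain A B where AB: "A \<in> P \<inter> D w" "B \<in> P \<inter> D w" "u A \<le> (k + 1/2) * \<sigma> - \<sigma>/2" "(k + 1/2) * \<sigma> + \<sigma>/2 \<le> u B"
        using midE[OF mid] by blast
      have w: "w \<in> W" using mid IWK by (auto simp: mid_def)
      have "\<bar>g A\<bar> \<le> \<omega>" "\<bar>g B\<bar> \<le> \<omega>" using AB P \<open>g = h \<or> _\<close> by auto
      then show ?thesis
        using AB P C \<sigma> \<rho> 
        by (intro strip_crossing[where A = A and B = B and C = C and \<tau> = "\<sigma>/2" and \<rho> = \<rho>, OF D[OF w] _ _ C(1) u g]) auto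
    qed
    note Z = *[OF that(1) that(3) that(5-7)] *[OF that(2) that(4) that(8-10)]
    obtain Z Z' where "Z \<in> D w" "Z' \<in> D w'" "u Z = u Z'" "g Z = g Z'"
      using Z by force
    then have "D w \<inter> D w' \<noteq> {}" using inj[of Z Z'] that(11) by auto
    then show "w = w'" using disj W by blast
  qed
  have card1: "card X \<le> card K" if "X \<subseteq> I" "\<And>w w' k. (w, k) \<in> X \<Longrightarrow> (w', k) \<in> X \<Longrightarrow> w = w'" for X
  proof (rule card_inj_on_le[of snd])
    show "inj_on snd X" using that by (auto simp: inj_on_def)
  qed (use that IWK K in auto)
  have card2: "card X \<le> card W" if "X \<subseteq> I" "\<And>w k k'. (w, k) \<in> X \<Longrightarrow> (w, k') \<in> X \<Longrightarrow> k = k'" for X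
  proof (rule card_inj_on_le[of fst])
    show "inj_on fst X" using that by (auto simp: inj_on_def)
  qed (use that IWK fin in auto)
  have lo: "card lo \<le> card W" by (rule card2) (auto simp: lo_def intro: order_antisym)
  have hi: "card hi \<le> card W" by (rule card2) (auto simp: hi_def intro: order_antisym)
  have ps: "card ps \<le> card K"
    using uniq[of _ _ _ _ _ h] by (intro card1) (auto simp: ps_def mid_def)
  have ng: "card ng \<le> card K"
    using uniq[of _ _ _ _ _ "\<lambda>x. - h x"] by (intro card1) (auto simp: ng_def mid_def)
  have "card I \<le> card (lo \<union> hi \<union> (ps \<union> ng))"
    by (rule card_mono[OF _ sub]) (rule finite_subset[OF _ finI], auto simp: lo_def hi_def ps_def ng_def mid_def)
  also have "\<dots> \<le> (card lo + card hi) + (card ps + card ng)"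
    by (meson add_mono card_Un_le order_trans)
  finally show "card I \<le> 2 * card K + 2 * card W" using lo hi ps ng by linarith
qed

section \<open>How often the fold splits a small set\<close>

definition spread :: "(real \<times> real) set \<Rightarrow> real \<Rightarrow> bool" where
  "spread P e \<longleftrightarrow> (\<forall>p\<in>P. \<forall>q\<in>P. \<bar>fst p - fst q\<bar> \<le> e \<and> \<bar>snd p - snd q\<bar> \<le> e)"

context tent_memory
begin

lemma avg_spread: "spread P e \<Longrightarrow> p \<in> P \<Longrightarrow> q \<in> P \<Longrightarrow> \<bar>avg p - avg q\<bar> \<le> e"
proof -
  assume "spread P e" "p \<in> P" "q \<in> P"
  then have e: "\<bar>fst p - fst q\<bar> \<le> e" "\<bar>snd p - snd q\<bar> \<le> e" by (auto simp: spread_def)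
  have "\<bar>avg p - avg q\<bar> = \<bar>a * (snd p - snd q) + (1 - a) * (fst p - fst q)\<bar>" by (simp add: avg_def algebra_simps)
  also have "\<dots> \<le> a * \<bar>snd p - snd q\<bar> + (1 - a) * \<bar>fst p - fst q\<bar>"
    using a_lo a_hi by (intro order_trans[OF abs_triangle_ineq]) (simp add: abs_mult)
  also have "\<dots> \<le> e" using e a_lo a_hi by (intro convex_bound_le) auto
  finally show ?thesis .
qed

lemma G_spread: assumes "spread P e" shows "spread (G a ` P) (2 * e)"
  unfolding spread_def
proof clarsimp
  fix x y x' y' assume p: "(x, y) \<in> P" "(x', y') \<in> P"
  have "\<bar>y - y'\<bar> \<le> e" using assms p unfolding spread_def by force
  moreover have "\<bar>avg (x, y) - avg (x', y')\<bar> \<le> e" by (rule avg_spread[OF assms p])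
  moreover have "\<bar>tent s - tent t\<bar> \<le> 2 * \<bar>s - t\<bar>" for s t by (auto simp: tent_def abs_if)
  ultimately show "\<bar>fst (G a (x, y)) - fst (G a (x', y'))\<bar> \<le> 2 * e \<and> \<bar>snd (G a (x, y)) - snd (G a (x', y'))\<bar> \<le> 2 * e"
    by (simp add: G_def avg_def) (smt (verit))
qed

lemma finite_itin: "finite (itin n ` P)"
  by (rule finite_subset[OF _ finite_lists_length_eq[of UNIV n]]) auto

lemma card_itin_Suc: "card (itin (Suc n) ` P) \<le> 2 * card (itin n ` G a ` P)"
proof -
  have "itin (Suc n) ` P \<subseteq> (\<lambda>(b, w). b # w) ` (UNIV \<times> itin n ` G a ` P)" by auto
  then have "card (itin (Suc n) ` P) \<le> card ((UNIV :: bool set) \<times> itin n ` G a ` P)"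
    by (rule surj_card_le[rotated]) (simp add: finite_itin)
  then show ?thesis by (simp add: card_cartesian_product)
qed

text \<open>For \<open>n = 0\<close> the truncated \<open>n - 1\<close> is again 0 and both sides
  agree, so that repeated use needs no lower bound on \<open>n\<close>.\<close>

lemma card_itin_unsplit:
  assumes "\<And>p. p \<in> P \<Longrightarrow> right p = b"
  shows "card (itin n ` P) \<le> card (itin (n - 1) ` G a ` P)"
proof (cases n)
  case 0
  have "itin 0 ` P = itin 0 ` G a ` P" by auto
  then show ?thesis using 0 by simp
next
  case (Suc m)
  have "itin (Suc m) ` P \<subseteq> (#) b ` (itin m ` G a ` P)" using assms by auto
  then show ?thesis using Suc by (simp add: surj_card_le finite_itin)
qed

lemma G_image_sq: "P \<subseteq> sq \<Longrightarrow> G a ` P \<subseteq> sq"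
  using G_sq by blast

lemma near_fold:
  assumes p: "p \<in> sq" and e: "\<bar>avg p - 1/2\<bar> \<le> e"
  shows "1 - 2 * e \<le> snd (G a p)"
  using e by (auto simp: G_Br Br_def)

text \<open>The height becomes the first coordinate of the image, which carries the weight 1 - a
  \<ge> 2/3 in the average. With \<open>near_fold\<close>, a point near the fold is therefore
  clearly on the right two steps later.\<close>

lemma after_fold:
  assumes p: "p \<in> sq" and y: "1 - e \<le> snd p" "e \<le> 1/100"
  shows "right (G a p)" "(1 - a) * (1 - e) \<le> avg (G a p)"
proof -
  have "0 \<le> snd (G a p)" using G_sq[OF p] by (simp add: sq_def mem_Times_iff)
  moreover have "(1 - a) * (1 - e) \<le> (1 - a) * snd p" using y a_hi by (intro mult_left_mono) auto
  moreover have "avg (G a p) = a * snd (G a p) + (1 - a) * snd p" by (simp add: avg_def G_def)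
  ultimately show *: "(1 - a) * (1 - e) \<le> avg (G a p)" using a_lo mult_nonneg_nonneg[of a "snd (G a p)"] by linarith
  have "2/3 * (99/100) \<le> (1 - a) * (1 - e)" using y a_hi by (intro mult_mono) auto
  with * show "right (G a p)" by (simp add: right_def)
qed

text \<open>Here p is near the fold and has height near 1, as after an earlier visit to the fold.
  Its orbit then passes close to (1,1), (1,0) and (0, 2a); at the last two the averages are close to
  1 - a > 1/2 and 2a^2 \<le> 2/9.\<close>

lemma after_double_fold:
  assumes p: "p \<in> sq" and e: "1 - e \<le> snd p" "e \<le> 1/100" and z: "\<bar>avg p - 1/2\<bar> \<le> e"
  shows "right (G a (G a p))" "\<not> right (G a (G a (G a p)))"
proof -
  have e0: "0 \<le> e" using z by linarith
  have q: "G a p \<in> sq" "G a (G a p) \<in> sq" by (simp_all add: G_sq p)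
  have s: "right (G a p)" by (rule after_fold[OF p e])
  have y1: "1 - 2 * e \<le> snd (G a p)" by (rule near_fold[OF p z])
  have s2: "right (G a (G a p))" "(1 - a) * (1 - 2 * e) \<le> avg (G a (G a p))"
    using after_fold[OF q(1), of "2 * e"] y1 e(2) a_hi
  proof -
    have "0 \<le> snd (G a (G a p))" using q by (simp add: sq_def mem_Times_iff)
    then have "(1 - a) * (1 - 2 * e) \<le> avg (G a (G a p))"
    proof -
      have "avg (G a (G a p)) = a * snd (G a (G a p)) + (1 - a) * snd (G a p)" by (simp add: avg_def G_def)
      then show ?thesis using \<open>0 \<le> snd (G a (G a p))\<close> a_lo a_hi mult_left_mono[OF y1, of "1 - a"]
        mult_nonneg_nonneg[of a "snd (G a (G a p))"] by linarith
    qed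
    moreover have "2/3 * (98/100) \<le> (1 - a) * (1 - 2 * e)" using e a_hi by (intro mult_mono) auto
    ultimately show "right (G a (G a p))" "(1 - a) * (1 - 2 * e) \<le> avg (G a (G a p))" by (simp_all add: right_def)
  qed
  show "right (G a (G a p))" by (rule s2)
  have f1: "fst (G a p) = snd p" by (simp add: G_def)
  have "a * (1 - 2 * e) + (1 - a) * (1 - 2 * e) \<le> a * snd (G a p) + (1 - a) * snd p"
    using y1 e e0 a_lo a_hi by (intro add_mono mult_left_mono) auto
  then have "1 - 2 * e \<le> avg (G a p)" by (simp add: avg_def f1 algebra_simps)
  then have y2: "snd (G a (G a p)) \<le> 4 * e" using s by (simp add: G_Br Br_def)
  have y3: "snd (G a (G a (G a p))) \<le> 2 - 2 * ((1 - a) * (1 - 2 * e))"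
    using s2 by (simp add: G_Br[of "G a (G a p)"] Br_def)
  have "2 * ((1 - a) * (1 - 2 * e)) = 2 - 2 * a - 4 * e + 4 * (a * e)" by (simp add: algebra_simps)
  then have "snd (G a (G a (G a p))) \<le> 2 * a + 4 * e" using y3 a_lo e0 mult_nonneg_nonneg[of a e] by linarith
  then have "a * snd (G a (G a (G a p))) \<le> 1/3 * (2/3 + 4 * e)"
    using a_lo a_hi e0 q by (intro mult_mono') (use G_sq[OF q(2)] in \<open>auto simp: sq_def mem_Times_iff\<close>)
  moreover have "(1 - a) * snd (G a (G a p)) \<le> 1 * (4 * e)"
    using a_lo a_hi y2 q by (intro mult_mono) (auto simp: sq_def mem_Times_iff)
  moreover have "fst (G a (G a (G a p))) = snd (G a (G a p))" by (simp add: G_def)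
  ultimately have "avg (G a (G a (G a p))) < 1/2" using e(2) by (simp add: avg_def)
  then show "\<not> right (G a (G a (G a p)))" by (simp add: right_def)
qed

text \<open>If a small set meets the fold, it does not meet it two steps later; if it meets the fold twice in a
  row, it does not do so in the next three steps. This gives the rate \<open>33/25\<close>, chosen with
  \<open>2 \<le> (33/25)^3\<close> and \<open>4 \<le> (33/25)^5\<close>.\<close>
lemma card_itin_le:
  assumes "P \<subseteq> sq" "spread P e" "e * 2 ^ n \<le> 1/1000"
  shows "real (card (itin n ` P)) \<le> 4 * (33/25) ^ n"
  using assms
proof (induction n arbitrary: P e rule: less_induct)
  case (less n)
  define P1 where "P1 = G a ` P" define P2 where "P2 = G a ` P1" define P3 where "P3 = G a ` P2"
  define P4 where "P4 = G a ` P3" define P5 where "P5 = G a ` P4"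
  have sq: "P1 \<subseteq> sq" "P2 \<subseteq> sq" "P3 \<subseteq> sq" "P4 \<subseteq> sq" "P5 \<subseteq> sq"
    unfolding P5_def P4_def P3_def P2_def P1_def by (intro G_image_sq less.prems)+
  have sp: "spread P1 (2 * e)" "spread P2 (4 * e)" "spread P3 (8 * e)" "spread P4 (16 * e)" "spread P5 (32 * e)"
    using less.prems(2) unfolding P5_def P4_def P3_def P2_def P1_def by (force dest: G_spread)+
  have c0: "card (itin 0 ` Q) \<le> 1" for Q using card_mono[of "{[]}" "itin 0 ` Q"] by auto
  \<comment> \<open>The induction pays for a doubling only when the set straddles the fold: one
    doubling is spread over three steps, two consecutive ones over five. The spread at most doubles
    per step while \<open>n\<close> drops, so \<open>e * 2 ^ n\<close> does not grow.\<close>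
  have k1: "(1::real) \<le> (33/25) ^ m" for m by simp
  show ?case
  proof (cases "n = 0")
    case True
    then show ?thesis using c0[of P] by simp
  next
    case n: False
    show ?thesis
    proof (cases "\<exists>b. \<forall>p\<in>P. right p = b")
      case True
      then have "card (itin n ` P) \<le> card (itin (n - 1) ` P1)"
        using card_itin_unsplit unfolding P1_def by blast
      moreover have "real (card (itin (n - 1) ` P1)) \<le> 4 * (33/25) ^ (n - 1)"
        using n less.prems(3) sq sp by (intro less.IH[of _ _ "2 * e"]) (auto simp: power_eq_if)
      moreover have "(33/25 :: real) ^ (n - 1) \<le> (33/25) ^ n" by (rule power_increasing) auto
      ultimately show ?thesis by linarith
    next
      case False
      then have "\<not> (\<forall>p\<in>P. right p = True)" "\<not> (\<forall>p\<in>P. right p = False)" by blast+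
      then obtain p q where pq: "p \<in> P" "q \<in> P" "right p" "\<not> right q" by auto
      have "0 \<le> e" using less.prems(2) pq by (force simp: spread_def)
      then have e: "e \<le> 1/1000" using less.prems(3) mult_left_mono[of 1 "2 ^ n" e] by simp
      have near: "\<bar>avg r - 1/2\<bar> \<le> e" if "r \<in> P" for r
        using avg_spread[OF less.prems(2) that pq(1)] avg_spread[OF less.prems(2) that pq(2)] pq(3,4)
        unfolding right_def by linarith
      then have P1y: "1 - 2 * e \<le> snd r" if "r \<in> P1" for r
        using near_fold less.prems(1) that unfolding P1_def by blast
      have s2: "right r = True" if "r \<in> P2" for r
        using that P1y after_fold(1)[of _ "2 * e"] sq e unfolding P2_def by auto
      obtain m where m: "n = Suc m" using n by (cases n) auto
      have c1: "card (itin n ` P) \<le> 2 * card (itin m ` P1)"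
        unfolding m P1_def by (rule card_itin_Suc)
      have c3: "card (itin (m - 1) ` P2) \<le> card (itin (m - 2) ` P3)"
        using card_itin_unsplit[where n = "m - 1", OF s2] by (simp add: P3_def numeral_2_eq_2)
      show ?thesis
      proof (cases "\<exists>b. \<forall>p\<in>P1. right p = b")
        case True
        then have "card (itin m ` P1) \<le> card (itin (m - 1) ` P2)"
          using card_itin_unsplit unfolding P2_def by blast
        moreover have m3: "n - 3 = m - 2" using m by simp
        ultimately have c: "card (itin n ` P) \<le> 2 * card (itin (n - 3) ` P3)" unfolding m3 using c1 c3 by linarith
        show ?thesis
        proof (cases "3 \<le> n")
          case True
          have "e * 2 ^ n = 8 * e * 2 ^ (n - 3)" using True by (simp add: power_diff)
          then have "real (card (itin (n - 3) ` P3)) \<le> 4 * (33/25) ^ (n - 3)"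
            using True less.prems(3) sq sp by (intro less.IH[of _ _ "8 * e"]) auto
          moreover have "2 * (33/25 :: real) ^ (n - 3) \<le> (33/25) ^ 3 * (33/25) ^ (n - 3)"
            by (intro mult_right_mono) (auto simp: power3_eq_cube)
          moreover have "(33/25 :: real) ^ 3 * (33/25) ^ (n - 3) = (33/25) ^ n" 
            using True by (simp flip: power_add)
          ultimately show ?thesis using c by linarith
        next
          case False
          \<comment> \<open>With too few steps left the truncated difference is 0 and a single empty
            itinerary remains; the constant 4 of the statement absorbs the doublings already
            made.\<close>
          then have n3: "n - 3 = 0" by simp
          have "card (itin n ` P) \<le> 4" using c c0[of P3] unfolding n3 by linarith
          then show ?thesis using k1[of n] by linarith
        qed
      next
        case False
        then have "\<not> (\<forall>p\<in>P1. right p = True)" "\<not> (\<forall>p\<in>P1. right p = False)" by blast+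
        then obtain p' q' where pq': "p' \<in> P1" "q' \<in> P1" "right p'" "\<not> right q'" by auto
        have near1: "\<bar>avg r - 1/2\<bar> \<le> 2 * e" if "r \<in> P1" for r
          using avg_spread[OF sp(1) that pq'(1)] avg_spread[OF sp(1) that pq'(2)] pq'(3,4)
          unfolding right_def by linarith
        have s3: "right r = True" if "r \<in> P3" for r
          using that P1y near1 after_double_fold(1)[of _ "2 * e"] sq e unfolding P3_def P2_def by auto
        have s4: "right r = False" if "r \<in> P4" for r
          using that P1y near1 after_double_fold(2)[of _ "2 * e"] sq e unfolding P4_def P3_def P2_def by auto
        have "card (itin m ` P1) \<le> 2 * card (itin (m - 1) ` P2)"
        proof (cases m)
          case 0
          have "card (itin 0 ` P1) = card (itin 0 ` P2)" by (rule arg_cong[of _ _ card]) (auto simp: P2_def)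
          then show ?thesis using 0 by simp
        qed (use card_itin_Suc in \<open>simp add: P2_def del: itin.simps\<close>)
        moreover have "card (itin (m - 2) ` P3) \<le> card (itin (m - 3) ` P4)"
          using card_itin_unsplit[where n = "m - 2", OF s3] by (simp add: P4_def numeral_3_eq_3 numeral_2_eq_2)
        moreover have "card (itin (m - 3) ` P4) \<le> card (itin (m - 4) ` P5)"
          using card_itin_unsplit[where n = "m - 3", OF s4] by (simp add: P5_def eval_nat_numeral)
        moreover have m5: "n - 5 = m - 4" using m by simp
        ultimately have c: "card (itin n ` P) \<le> 4 * card (itin (n - 5) ` P5)"
          unfolding m5 using c1 c3 by linarith
        show ?thesis
        proof (cases "5 \<le> n")
          case True
          have "e * 2 ^ n = 32 * e * 2 ^ (n - 5)" using True by (simp add: power_diff)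
          then have "real (card (itin (n - 5) ` P5)) \<le> 4 * (33/25) ^ (n - 5)"
            using True less.prems(3) sq sp by (intro less.IH[of _ _ "32 * e"]) auto
          moreover have "4 * (33/25 :: real) ^ (n - 5) \<le> (33/25) ^ 5 * (33/25) ^ (n - 5)"
            by (intro mult_right_mono) (auto simp: eval_nat_numeral)
          moreover have "(33/25 :: real) ^ 5 * (33/25) ^ (n - 5) = (33/25) ^ n" 
            using True by (simp flip: power_add)
          ultimately show ?thesis using c by linarith
        next
          case False
          then have n5: "n - 5 = 0" by simp
          have "card (itin n ` P) \<le> 4" using c c0[of P5] unfolding n5 by linarith
          then show ?thesis using k1[of n] by linarith
        qed
      qed
    qed
  qed
qed

end

section \<open>Cutting a set into pieces\<close>

lemma fmeasurable_subset_square: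
  fixes D :: "(real \<times> real) set"
  assumes "D \<in> sets borel" "D \<subseteq> {0..1} \<times> {0..1}"
  shows "D \<in> fmeasurable lborel"
proof -
  have "emeasure lborel D \<le> emeasure lborel ({0..1::real} \<times> {0..1::real})"
    using assms by (intro emeasure_mono) (auto intro: borel_closed closed_Times)
  also have "\<dots> < \<infinity>" using lborel_square[of 0 1 0 1] by simp
  finally show ?thesis using assms by (simp add: fmeasurable_def)
qed

text \<open>Labels are pairs so that one type serves the square grid, the parallel strips (second
  label 0) and the trivial cut.\<close>

definition slicing :: "(real \<times> real \<Rightarrow> int \<times> int) \<Rightarrow> bool" where
  "slicing c \<longleftrightarrow> (\<forall>k. convex {p. c p = k} \<and> {p. c p = k} \<in> sets borel)"

lemma floor_fibre:
  fixes u :: "real \<times> real \<Rightarrow> real"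
  assumes "linear u"
  shows "convex {p. \<lfloor>u p / \<sigma>\<rfloor> = k} \<and> {p. \<lfloor>u p / \<sigma>\<rfloor> = k} \<in> sets borel"
proof -
  have eq: "{p. \<lfloor>u p / \<sigma>\<rfloor> = k} = (\<lambda>p. u p / \<sigma>) -` {k..<k+1}"
    by (auto simp: floor_eq_iff)
  have "linear (\<lambda>p. u p / \<sigma>)" using assms by (simp add: linear_iff add_divide_distrib)
  then have "convex ((\<lambda>p. u p / \<sigma>) -` {real_of_int k..<k+1})"
    by (rule convex_linear_vimage) simp
  moreover have "u \<in> borel_measurable borel"
    using assms by (intro borel_measurable_continuous_onI linear_continuous_on) (simp add: linear_conv_bounded_linear)
  then have "(\<lambda>p. u p / \<sigma>) \<in> borel_measurable borel" by simp
  then have "(\<lambda>p. u p / \<sigma>) -` {real_of_int k..<k+1} \<in> sets borel"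
    using measurable_sets[of _ borel borel "{real_of_int k..<k+1}"] by simp
  ultimately show ?thesis by (simp add: eq)
qed

lemma slicing_floor:
  "slicing (\<lambda>p. (\<lfloor>fst p / \<sigma>\<rfloor>, \<lfloor>snd p / \<sigma>\<rfloor>))"
  "slicing (\<lambda>p. (\<lfloor>fst p / \<sigma>\<rfloor>, 0))"
  "slicing (\<lambda>p. (\<lfloor>snd p / \<sigma>\<rfloor>, 0))"
  "slicing (\<lambda>p. (0, 0))"
proof -
  have l: "linear (fst :: real \<times> real \<Rightarrow> real)" "linear (snd :: real \<times> real \<Rightarrow> real)"
    by (simp_all add: linear_iff)
  note f = floor_fibre[OF l(1), of \<sigma>] floor_fibre[OF l(2), of \<sigma>]
  have "{p. (\<lfloor>fst p / \<sigma>\<rfloor>, \<lfloor>snd p / \<sigma>\<rfloor>) = k} = {p. \<lfloor>fst p / \<sigma>\<rfloor> = fst k} \<inter> {p. \<lfloor>snd p / \<sigma>\<rfloor> = snd k}" for k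
    by (auto simp: prod_eq_iff)
  then show "slicing (\<lambda>p. (\<lfloor>fst p / \<sigma>\<rfloor>, \<lfloor>snd p / \<sigma>\<rfloor>))"
    using f by (auto simp: slicing_def intro!: convex_Int)
  have *: "slicing (\<lambda>p. (f p, 0))" if "\<And>k. convex {p. f p = k} \<and> {p. f p = k} \<in> sets borel" for f :: "real \<times> real \<Rightarrow> int"
    unfolding slicing_def
  proof
    fix k :: "int \<times> int"
    have "{p. (f p, 0) = k} = (if snd k = 0 then {p. f p = fst k} else {})" by (auto simp: prod_eq_iff)
    then show "convex {p. (f p, 0) = k} \<and> {p. (f p, 0) = k} \<in> sets borel" using that by simp
  qed
  show "slicing (\<lambda>p. (\<lfloor>fst p / \<sigma>\<rfloor>, 0))" "slicing (\<lambda>p. (\<lfloor>snd p / \<sigma>\<rfloor>, 0))" using f by (auto intro!: *)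
  show "slicing (\<lambda>p. (0, 0))" by (rule *) simp
qed

lemma card_floor_le:
  fixes u :: "'a \<Rightarrow> real"
  assumes \<sigma>: "0 < \<sigma>" and u: "\<And>p q. p \<in> P \<Longrightarrow> q \<in> P \<Longrightarrow> \<bar>u p - u q\<bar> \<le> real m * \<sigma>"
  shows "finite ((\<lambda>r. \<lfloor>u r / \<sigma>\<rfloor>) ` P) \<and> card ((\<lambda>r. \<lfloor>u r / \<sigma>\<rfloor>) ` P) \<le> m + 1"
proof (cases "P = {}")
  case False
  let ?K = "(\<lambda>r. \<lfloor>u r / \<sigma>\<rfloor>) ` P"
  have diff: "k \<le> k' + int m" if k: "k \<in> ?K" "k' \<in> ?K" for k k'
  proof -
    obtain p q where pq: "p \<in> P" "q \<in> P" "k = \<lfloor>u p / \<sigma>\<rfloor>" "k' = \<lfloor>u q / \<sigma>\<rfloor>" using k by auto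
    have "u p / \<sigma> \<le> u q / \<sigma> + m" using u[OF pq(1,2)] \<sigma> by (simp add: field_simps abs_le_iff)
    then show ?thesis unfolding pq by linarith
  qed
  obtain k0 where k0: "k0 \<in> ?K" using False by auto
  then have "?K \<subseteq> {k0 - int m..k0 + int m}" using diff by fastforce
  then have fin: "finite ?K" by (rule finite_subset) simp
  have mn: "Min ?K \<in> ?K" by (rule Min_in[OF fin]) (use False in auto)
  have "?K \<subseteq> {Min ?K..Min ?K + int m}" using diff[OF _ mn] Min_le[OF fin] by auto
  then have "card ?K \<le> card {Min ?K..Min ?K + int m}" by (rule card_mono[rotated]) simp
  with fin show ?thesis by simp
qed simp

context tent_memory
begin

lemma sq_borel [measurable]: "sq \<in> sets borel"
  unfolding sq_def by (intro borel_closed closed_Times) auto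

lemma fmeasurable_sq: "D \<in> sets borel \<Longrightarrow> D \<subseteq> sq \<Longrightarrow> D \<in> fmeasurable lborel"
  unfolding sq_def by (rule fmeasurable_subset_square)

text \<open>The index set of the nonempty pieces of \<open>P\<close>. Cylinders that are null in the
  square are left out: they carry no area, and only the others have a common positive lower bound
  for their area, which the strip argument requires.\<close>

definition pieces :: "nat \<Rightarrow> (real \<times> real \<Rightarrow> int \<times> int) \<Rightarrow> (real \<times> real) set \<Rightarrow> (bool list \<times> int \<times> int) set" where
  "pieces n c P = {(w, k). length w = n \<and> 0 < measure lborel (cyl w \<inter> sq) \<and> (\<exists>r\<in>P \<inter> cyl w. c r = k)}"

text \<open>A Lasota-Yorke type inequality. On each piece the iterate is one affine map of area
  factor \<open>d ^ n\<close>, and its image is again convex, small and inside \<open>U\<close>, so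
  \<open>hyp\<close> applies to it. Pulling back, the term \<open>x\<close> is paid once per piece
  and divided by \<open>d ^ n\<close>, while the term \<open>y\<close> is proportional to area and
  adds up to the area of \<open>P\<close>.\<close>

lemma measure_step:
  assumes P: "convex P" "P \<in> sets borel" "P \<subseteq> U" and c: "slicing c"
    and J: "finite (pieces n c P)" "real (card (pieces n c P)) \<le> M"
    and small: "\<And>k. spread {r \<in> P. c r = k} e" and e: "Lam n * e \<le> \<delta>"
    and E: "E \<in> sets borel" and xyL: "0 \<le> x" "0 \<le> y" "0 \<le> L"
    and hyp: "\<And>Q. convex Q \<Longrightarrow> Q \<in> sets borel \<Longrightarrow> Q \<subseteq> U \<Longrightarrow> spread Q \<delta> \<Longrightarrow>
      measure lborel (Q \<inter> E) \<le> (x + y * measure lborel Q) * L"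
  shows "measure lborel (P \<inter> (G a ^^ n) -` E) \<le> (M * x / d ^ n + y * measure lborel P) * L"
proof -
  define R where "R = (\<lambda>(w, k). P \<inter> cyl w \<inter> {r. c r = k})"
  define J where "J = pieces n c P"
  define Z where "Z = (\<Union>w\<in>{w. length w = n \<and> measure lborel (cyl w \<inter> sq) = 0}. cyl w \<inter> sq)"
  have d: "0 < d ^ n" using d_bounds by simp
  have Psq: "P \<subseteq> sq" using P(3) U_sq by blast
  have Rb: "R j \<in> sets borel" for j
    using P c unfolding R_def slicing_def by (cases j) auto
  have Rsq: "R j \<subseteq> sq" "R j \<subseteq> P" for j using Psq by (auto simp: R_def split: prod.splits)
  have Rf: "R j \<in> fmeasurable lborel" for j using fmeasurable_sq Rb Rsq by blast
  have Rc: "convex (R j)" for j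
    using P c cyl_convex unfolding R_def slicing_def by (cases j) (auto intro!: convex_Int)
  have GE: "(G a ^^ n) -` E \<in> sets borel" using measurable_sets[OF Gn_measurable E] by simp
  have finW: "finite {w :: bool list. length w = n}" using finite_lists_length_eq[of "UNIV :: bool set" n] by simp
  \<comment> \<open>\<open>Z\<close> collects the points whose cylinder was dropped from
    \<open>pieces\<close>.\<close>
  have "Z \<in> null_sets lborel"
    unfolding Z_def
  proof (rule null_sets.finite_UN)
    show "finite {w. length w = n \<and> measure lborel (cyl w \<inter> sq) = 0}" by (rule finite_subset[OF _ finW]) auto
    fix w assume w: "w \<in> {w. length w = n \<and> measure lborel (cyl w \<inter> sq) = 0}"
    have "cyl w \<inter> sq \<in> fmeasurable lborel" by (rule fmeasurable_sq) auto
    then have "emeasure lborel (cyl w \<inter> sq) = 0" using w by (auto simp: emeasure_eq_measure2)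
    then show "cyl w \<inter> sq \<in> null_sets lborel" by auto
  qed
  then have Z: "Z \<in> fmeasurable lborel" "measure lborel Z = 0"
    by (auto simp: fmeasurable_def measure_def null_sets_def)
  have cover: "P \<inter> (G a ^^ n) -` E \<subseteq> (\<Union>j\<in>J. R j \<inter> (G a ^^ n) -` E) \<union> Z"
  proof
    fix r assume r: "r \<in> P \<inter> (G a ^^ n) -` E"
    define w where "w = itin n r"
    have w: "length w = n" "r \<in> cyl w" by (simp_all add: w_def cyl_def)
    show "r \<in> (\<Union>j\<in>J. R j \<inter> (G a ^^ n) -` E) \<union> Z"
    proof (cases "measure lborel (cyl w \<inter> sq) = 0")
      case True
      then have "r \<in> Z" using w r Psq by (auto simp: Z_def)
      then show ?thesis by blast
    next
      case False
      then have "0 < measure lborel (cyl w \<inter> sq)" by (simp add: order_less_le)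
      then have "(w, c r) \<in> J" "r \<in> R (w, c r)" using w r by (auto simp: J_def pieces_def R_def)
      then show ?thesis using r by blast
    qed
  qed
  have RE: "R j \<inter> (G a ^^ n) -` E \<in> fmeasurable lborel" for j
    using Rsq[of j] Rb[of j] GE by (intro fmeasurable_sq) auto
  have piece: "d ^ n * measure lborel (R j \<inter> (G a ^^ n) -` E) \<le> (x + y * (d ^ n * measure lborel (R j))) * L"
    if j: "j \<in> J" for j
  proof -
    obtain w k where jj: "j = (w, k)" by (cases j)
    have w: "length w = n" using j by (auto simp: J_def pieces_def jj)
    obtain r where r: "r \<in> P" "r \<in> cyl w" using j by (auto simp: J_def pieces_def jj)
    have it: "itin n s = w" if "s \<in> R j" for s using that w by (auto simp: R_def jj cyl_def)
    have iw: "itin n r = w" using r w by (auto simp: cyl_def)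
    let ?Q = "Brw w ` R j"
    have Gs: "(G a ^^ n) s = Brw w s" if "s \<in> R j" for s using Brw_itin[of n s] it[OF that] by simp
    have Qeq: "?Q = (G a ^^ n) ` R j"
      by (rule image_cong[OF refl]) (simp add: Gs)
    have QU: "?Q \<subseteq> U" unfolding Qeq using Rsq(2) P(3) Gn_U by blast
    have Qb: "?Q \<in> sets borel" by (rule Brw_image_borel[OF Rb])
    have sp: "spread ?Q \<delta>"
      unfolding spread_def
    proof (intro ballI)
      fix p' q' assume "p' \<in> ?Q" "q' \<in> ?Q"
      then obtain p q where pq: "p \<in> R j" "q \<in> R j" and pq': "p' = Brw w p" "q' = Brw w q" by blast
      have "\<bar>fst p - fst q\<bar> \<le> e" "\<bar>snd p - snd q\<bar> \<le> e"
      proof -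
        have "p \<in> {r \<in> P. c r = k}" "q \<in> {r \<in> P. c r = k}" using pq by (auto simp: R_def jj)
        then show "\<bar>fst p - fst q\<bar> \<le> e" "\<bar>snd p - snd q\<bar> \<le> e" using small[of k] unfolding spread_def by blast+
      qed
      moreover have "r \<in> U" using r P(3) by blast
      ultimately show "\<bar>fst p' - fst q'\<bar> \<le> \<delta> \<and> \<bar>snd p' - snd q'\<bar> \<le> \<delta>"
        using Brw_itin_lipschitz[of r p q e n] e unfolding pq' iw by linarith
    qed
    have v1: "Brw w -` ?Q = R j" by (rule inj_vimage_image_eq[OF inj_Brw])
    have v2: "Brw w -` (?Q \<inter> E) = R j \<inter> (G a ^^ n) -` E"
    proof -
      have "Brw w -` (?Q \<inter> E) = R j \<inter> Brw w -` E" using v1 by blast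
      also have "\<dots> = R j \<inter> (G a ^^ n) -` E" using Gs by auto
      finally show ?thesis .
    qed
    have "d ^ n * measure lborel (R j \<inter> (G a ^^ n) -` E) = measure lborel (?Q \<inter> E)"
      using measure_Brw_vimage[of "?Q \<inter> E" w] Qb E w unfolding v2 by auto
    also have "\<dots> \<le> (x + y * measure lborel ?Q) * L"
      by (rule hyp[OF convex_Brw_image[OF Rc] Qb QU sp])
    also have "measure lborel ?Q = d ^ n * measure lborel (R j)"
      using measure_Brw_vimage[OF Qb, of w] w unfolding v1 by simp
    finally show ?thesis .
  qed
  have disj: "disjoint_family_on R J"
    unfolding disjoint_family_on_def
  proof clarify
    fix w k w' k' assume j: "(w, k) \<in> J" "(w', k') \<in> J" "R (w, k) \<inter> R (w', k') \<noteq> {}"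
    then obtain s where s: "s \<in> R (w, k)" "s \<in> R (w', k')" by blast
    have "length w = length w'" using j by (simp add: J_def pieces_def)
    then show "w = w' \<and> k = k'" using s by (auto simp: R_def cyl_def)
  qed
  have "(\<Sum>j\<in>J. measure lborel (R j)) = measure lborel (\<Union>j\<in>J. R j)"
    using Rb fmeasurableD2[OF Rf] J disj by (intro measure_finite_Union[symmetric]) (auto simp: J_def)
  also have "\<dots> \<le> measure lborel P"
    using Rsq(2) P(2) Rb fmeasurable_sq[OF P(2) Psq] J
    by (intro measure_mono_fmeasurable) (auto simp: J_def)
  finally have sumR: "(\<Sum>j\<in>J. measure lborel (R j)) \<le> measure lborel P" .
  have fU: "(\<Union>j\<in>J. R j \<inter> (G a ^^ n) -` E) \<in> fmeasurable lborel"
    unfolding J_def using RE by (intro fmeasurable.finite_UN[OF J(1)]) auto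
  have "measure lborel (P \<inter> (G a ^^ n) -` E) \<le> measure lborel ((\<Union>j\<in>J. R j \<inter> (G a ^^ n) -` E) \<union> Z)"
    using cover P(2) GE fU Z by (intro measure_mono_fmeasurable) (auto intro: fmeasurable.Un)
  also have "\<dots> \<le> measure lborel (\<Union>j\<in>J. R j \<inter> (G a ^^ n) -` E) + measure lborel Z"
    using fU Z by (intro measure_Un_le) auto
  also have "\<dots> \<le> (\<Sum>j\<in>J. measure lborel (R j \<inter> (G a ^^ n) -` E))"
  proof -
    have "R j \<inter> (G a ^^ n) -` E \<in> sets lborel" for j using fmeasurableD[OF RE] .
    then show ?thesis
      using Z(2) measure_UNION_le[OF J(1)[folded J_def], of "\<lambda>j. R j \<inter> (G a ^^ n) -` E" lborel] by simp
  qed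
  also have "\<dots> \<le> (\<Sum>j\<in>J. (x / d ^ n + y * measure lborel (R j)) * L)"
  proof (rule sum_mono)
    fix j assume "j \<in> J"
    moreover have "(x + y * (d ^ n * measure lborel (R j))) * L = d ^ n * ((x / d ^ n + y * measure lborel (R j)) * L)"
      using d_bounds by (simp add: field_simps)
    ultimately have "d ^ n * measure lborel (R j \<inter> (G a ^^ n) -` E) \<le> d ^ n * ((x / d ^ n + y * measure lborel (R j)) * L)"
      using piece by metis
    then show "measure lborel (R j \<inter> (G a ^^ n) -` E) \<le> (x / d ^ n + y * measure lborel (R j)) * L"
      using d by (simp only: mult_le_cancel_left_pos)
  qed
  also have "\<dots> = (card J * x / d ^ n + y * (\<Sum>j\<in>J. measure lborel (R j))) * L"
    by (simp add: sum_distrib_left sum_distrib_right[symmetric] sum.distrib)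
  also have "\<dots> \<le> (M * x / d ^ n + y * measure lborel P) * L"
    using J(2) sumR xyL d by (intro mult_right_mono add_mono divide_right_mono mult_left_mono) (auto simp: J_def)
  finally show ?thesis .
qed

section \<open>The number of pieces of a thin set\<close>

lemma ex_contraction:
  "\<exists>n. 2 * (3 * Lam n + 2) + 8 * (33/25) ^ n \<le> d ^ n / 2"
proof -
  \<comment> \<open>The three sequences are the summands 6 \<open>Lam n\<close>, 4 and 8 (33/25)^n,
    divided by \<open>d ^ n\<close> or, for the last two, by its lower bound (4/3)^n: 150 = 6 * 25
    and 99/100 = (33/25) * (3/4). Each is made smaller than 1/8.\<close>
  have t: "(\<lambda>n. 150 * sqrt (99/100) ^ n) \<longlonglongrightarrow> 150 * 0" "(\<lambda>n. 4 * (3/4 :: real) ^ n) \<longlonglongrightarrow> 4 * 0"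
    "(\<lambda>n. 8 * (99/100 :: real) ^ n) \<longlonglongrightarrow> 8 * 0"
    by (intro tendsto_mult tendsto_const LIMSEQ_power_zero; simp add: real_less_lsqrt)+
  have "\<forall>\<^sub>F n in sequentially. 150 * sqrt (99/100) ^ n < 1/8" "\<forall>\<^sub>F n in sequentially. 4 * (3/4 :: real) ^ n < 1/8"
    "\<forall>\<^sub>F n in sequentially. 8 * (99/100 :: real) ^ n < 1/8"
    by (rule order_tendstoD(2)[OF t(1)], simp, rule order_tendstoD(2)[OF t(2)], simp, rule order_tendstoD(2)[OF t(3)], simp)
  then have "\<forall>\<^sub>F n in sequentially. 150 * sqrt (99/100) ^ n < 1/8 \<and> 4 * (3/4 :: real) ^ n < 1/8 \<and> 8 * (99/100 :: real) ^ n < 1/8"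
    by eventually_elim simp
  then obtain n where n: "150 * sqrt (99/100) ^ n < 1/8" "4 * (3/4 :: real) ^ n < 1/8" "8 * (99/100 :: real) ^ n < 1/8"
    unfolding eventually_sequentially by blast
  have d: "0 < d ^ n" "(4/3) ^ n \<le> d ^ n" using d_bounds by (auto intro: power_mono)
  have "150 * sqrt (99/100) ^ n * d ^ n \<le> 1/8 * d ^ n" using n(1) d by (intro mult_right_mono) auto
  moreover have "4 \<le> 1/8 * d ^ n"
  proof -
    have "4 = 4 * (3/4) ^ n * (4/3 :: real) ^ n" by (simp flip: power_mult_distrib)
    also have "\<dots> \<le> 1/8 * d ^ n" using n(2) d by (intro mult_mono) auto
    finally show ?thesis .
  qed
  moreover have "8 * (33/25) ^ n \<le> 1/8 * d ^ n"
  proof -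
    have "8 * (33/25) ^ n = 8 * (99/100) ^ n * (4/3 :: real) ^ n" by (simp flip: power_mult_distrib)
    also have "\<dots> \<le> 1/8 * d ^ n" using n(3) d by (intro mult_mono) auto
    finally show ?thesis .
  qed
  ultimately have "150 * sqrt (99/100) ^ n * d ^ n + 4 + 8 * (33/25) ^ n \<le> 1/8 * d ^ n + 1/8 * d ^ n + 1/8 * d ^ n"
    by (intro add_mono)
  also have "\<dots> \<le> d ^ n / 2" using d by simp
  finally have "2 * (3 * Lam n + 2) + 8 * (33/25) ^ n \<le> d ^ n / 2" by (simp add: Lam_def)
  then show ?thesis by blast
qed

text \<open>The points within vertical distance \<rho> of a line over the unit interval form a
  sheared rectangle of area 2 \<rho>, too small to contain D.\<close>

lemma far_from_line:
  fixes s c :: real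
  assumes uv: "(u, v) = (fst, snd) \<or> (u, v) = (snd, fst)"
    and D: "D \<in> sets borel" "D \<subseteq> sq" "2 * \<rho> < measure lborel D" and \<rho>: "0 \<le> \<rho>"
  shows "\<exists>C\<in>D. \<rho> \<le> \<bar>v C - s * u C - c\<bar> \<and> 0 \<le> u C \<and> u C \<le> 1"
proof (rule ccontr)
  assume n: "\<not> ?thesis"
  let ?Q = "{0..1::real} \<times> {- \<rho>..\<rho>}"
  let ?L = "\<lambda>C. (u C, v C - s * u C - c)"
  have Q: "?Q \<in> sets borel" by (intro borel_closed closed_Times) auto
  have sub: "D \<subseteq> ?L -` ?Q"
  proof
    fix C assume C: "C \<in> D"
    then have "0 \<le> u C" "u C \<le> 1" using D(2) uv by (auto simp: sq_def mem_Times_iff)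
    then show "C \<in> ?L -` ?Q" using n C by force
  qed
  obtain a1 b1 c1 f1 where L: "?L = (\<lambda>p. (a1 * fst p + b1 * snd p + 0, c1 * fst p + f1 * snd p + (- c)))"
    and det: "a1 * f1 - b1 * c1 \<noteq> 0" "\<bar>a1 * f1 - b1 * c1\<bar> = 1"
  proof (rule disjE[OF uv])
    assume "(u, v) = (fst, snd)"
    then show ?thesis by (intro that[of 1 0 "- s" 1]) auto
  next
    assume "(u, v) = (snd, fst)"
    then show ?thesis by (intro that[of 0 1 1 "- s"]) auto
  qed
  have m: "measure lborel (?L -` ?Q) = 2 * \<rho>"
    using measure_affine_vimage[OF Q det(1), of 0 "- c"] measure_lborel_square[of 0 1 "- \<rho>" \<rho>] \<rho>
    unfolding L det(2) by simp
  have em: "emeasure lborel (?L -` ?Q) = emeasure lborel ?Q"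
    using emeasure_affine_vimage[OF Q det(1), of 0 "- c"] unfolding L det(2) by simp
  have "?L -` ?Q \<in> sets borel" unfolding L using measurable_sets[OF measurable_affine_pair[of a1 b1 0 c1 f1 "- c"] Q] by simp
  moreover have "emeasure lborel (?L -` ?Q) < \<infinity>" unfolding em using lborel_square[of 0 1 "- \<rho>" \<rho>] \<rho> by simp
  ultimately have "measure lborel D \<le> measure lborel (?L -` ?Q)"
    using sub D(1) by (intro measure_mono_fmeasurable) (auto simp: fmeasurable_def)
  with m D(3) show False by simp
qed

text \<open>A small area together with two points at distance at least \<sigma> confines
  \<open>P\<close> to a strip around the line pq, to which \<open>strip_count\<close> applies with
  the cylinders as the convex sets. Since \<open>u\<close> is the direction in which p and q differ
  most, the line has slope at most 1 and slicing along \<open>u\<close> alone makes the pieces small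
  in both coordinates.\<close>

lemma thin_pieces:
  assumes P: "convex P" "P \<in> sets borel" "P \<subseteq> U" and uv: "(u, v) = (fst, snd) \<or> (u, v) = (snd, fst)"
    and pq: "p \<in> P" "q \<in> P" "\<sigma> \<le> \<bar>u q - u p\<bar>" "\<bar>v q - v p\<bar> \<le> \<bar>u q - u p\<bar>"
    and \<sigma>: "0 < \<sigma>" and \<rho>: "0 < \<rho>" "\<rho> \<le> 1" and area: "measure lborel P < \<sigma>\<^sup>2 * \<rho> / 16"
    and fat: "\<And>w. length w = n \<Longrightarrow> 0 < measure lborel (cyl w \<inter> sq) \<Longrightarrow> 2 * \<rho> < measure lborel (cyl w \<inter> sq)"
    and ext: "\<And>p q. p \<in> P \<Longrightarrow> q \<in> P \<Longrightarrow> \<bar>u p - u q\<bar> \<le> real m * \<sigma>"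
  defines "c \<equiv> (\<lambda>r. (\<lfloor>u r / \<sigma>\<rfloor>, 0))"
  shows "finite (pieces n c P)" "card (pieces n c P) \<le> 2 * (m + 1) + 2 * card (itin n ` P)"
    "\<And>k. spread {r \<in> P. c r = k} (3 * \<sigma>)"
proof -
  have Psq: "P \<subseteq> sq" using P U_sq by blast
  define s where "s = (v q - v p) / (u q - u p)"
  define c0 where "c0 = v p - s * u p"
  define h where "h = (\<lambda>r. v r - s * u r - c0)"
  \<comment> \<open>The half-height of the strip: by the triangle bound, \<sigma> |h| is at most
    four times the area, hence below \<sigma>^2 \<rho> / 4. The factor 16 in \<open>area\<close> is
    chosen to give 4 \<omega> = \<sigma> \<rho>, as \<open>strip_count\<close> demands.\<close>
  define \<omega> where "\<omega> = \<sigma> * \<rho> / 4"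
  have upq: "u q - u p \<noteq> 0" using pq \<sigma> by auto
  have s1: "\<bar>s\<bar> \<le> 1" using pq upq by (simp add: s_def abs_divide divide_le_eq_1)
  have lin: "u ((1 - t) *\<^sub>R x + t *\<^sub>R y) = (1 - t) * u x + t * u y" "v ((1 - t) *\<^sub>R x + t *\<^sub>R y) = (1 - t) * v x + t * v y" for x y t
    using uv by auto
  have hl: "h ((1 - t) *\<^sub>R x + t *\<^sub>R y) = (1 - t) * h x + t * h y" for x y t
    unfolding h_def lin by (simp add: algebra_simps)
  have inj: "x = y" if "u x = u y" "h x = h y" for x y
    using that uv by (auto simp: h_def prod_eq_iff)
  have u01: "0 \<le> u r" "u r \<le> 1" if "r \<in> sq" for r using that uv by (auto simp: sq_def mem_Times_iff)
  have hP: "\<bar>h r\<bar> \<le> \<omega>" if r: "r \<in> P" for r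
  proof -
    have "emeasure lborel P < \<infinity>" using fmeasurable_sq[OF P(2) Psq] by (simp add: fmeasurable_def)
    from convex_measure_triangle[OF P(1,2) this pq(1,2) r]
    have tri: "\<bar>(u q - u p) * (v r - v p) - (v q - v p) * (u r - u p)\<bar> \<le> 4 * measure lborel P"
      using uv by (auto simp: abs_minus_commute mult.commute)
    have "(u q - u p) * h r = (u q - u p) * (v r - v p) - (v q - v p) * (u r - u p)"
    proof -
      have "s * (u q - u p) = v q - v p" using upq by (simp add: s_def)
      moreover have "(u q - u p) * h r = (u q - u p) * (v r - v p) - (s * (u q - u p)) * (u r - u p)"
        by (simp add: h_def c0_def algebra_simps)
      ultimately show ?thesis by simp
    qed
    then have "\<bar>u q - u p\<bar> * \<bar>h r\<bar> \<le> 4 * measure lborel P" using tri by (simp flip: abs_mult)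
    moreover have "\<sigma> * \<bar>h r\<bar> \<le> \<bar>u q - u p\<bar> * \<bar>h r\<bar>" using pq by (intro mult_right_mono) auto
    ultimately have "\<sigma> * \<bar>h r\<bar> \<le> \<sigma> * \<omega>" using area by (simp add: \<omega>_def power2_eq_square)
    then show ?thesis using \<sigma> by simp
  qed
  define W where "W = {w \<in> itin n ` P. 0 < measure lborel (cyl w \<inter> sq)}"
  have W: "finite W" "card W \<le> card (itin n ` P)"
    using finite_itin by (auto simp: W_def intro: card_mono)
  have lenW: "length w = n" if "w \<in> W" for w using that by (auto simp: W_def)
  let ?D = "\<lambda>w. cyl w \<inter> sq" let ?K = "(\<lambda>r. \<lfloor>u r / \<sigma>\<rfloor>) ` P"
  have K: "finite ?K" "card ?K \<le> m + 1" using card_floor_le[where u = u and P = P and m = m, OF \<sigma> ext] by auto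
  define I where "I = {(w, k). w \<in> W \<and> (\<exists>r\<in>P \<inter> ?D w. \<lfloor>u r / \<sigma>\<rfloor> = k)}"
  have sqc: "convex sq" unfolding sq_def by (intro convex_Times) auto
  have far: "\<exists>C\<in>?D w. \<rho> \<le> \<bar>h C\<bar> \<and> 0 \<le> u C \<and> u C \<le> 1" if "w \<in> W" for w
    unfolding h_def using that lenW fat \<rho>
    by (intro far_from_line[OF uv]) (auto simp: W_def)
  have dj: "?D w \<inter> ?D w' = {}" if "w \<in> W" "w' \<in> W" "w \<noteq> w'" for w w'
    using that lenW by (auto simp: cyl_def)
  have DW: "convex (?D w)" if "w \<in> W" for w by (rule convex_Int[OF cyl_convex sqc])
  have PW: "\<bar>h r\<bar> \<le> \<omega> \<and> 0 \<le> u r \<and> u r \<le> 1" if "r \<in> P" for r using hP u01 Psq that by blast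
  have w1: "4 * \<omega> \<le> \<sigma> * \<rho>" "0 \<le> \<rho>" using \<rho> by (auto simp: \<omega>_def)
  have PK: "\<lfloor>u r / \<sigma>\<rfloor> \<in> ?K" if "r \<in> P" for r using that by (rule imageI)
  note sc = strip_count[where W = W and D = ?D and u = u and h = h and P = P and \<omega> = \<omega> and \<rho> = \<rho> and \<sigma> = \<sigma> and K = ?K,
      OF W(1) DW dj lin(1) hl inj PW far \<sigma> w1 K(1) PK]
  have I1: "finite I" unfolding I_def by (rule sc(1))
  have I2: "card I \<le> 2 * card ?K + 2 * card W" unfolding I_def by (rule sc(2))
  note I = I1 I2
  have sub: "pieces n c P \<subseteq> (\<lambda>(w, k). (w, k, 0)) ` I"
  proof clarify
    fix w k l assume "(w, k, l) \<in> pieces n c P"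
    then obtain r where r: "length w = n" "0 < measure lborel (cyl w \<inter> sq)" "r \<in> P" "r \<in> cyl w" "(\<lfloor>u r / \<sigma>\<rfloor>, 0) = (k, l)"
      by (auto simp: pieces_def c_def)
    then have "w = itin n r" by (simp add: cyl_def)
    then have "w \<in> W" using r by (auto simp: W_def)
    then have "(w, k) \<in> I" using r Psq by (auto simp: I_def)
    then show "(w, k, l) \<in> (\<lambda>(w, k). (w, k, 0)) ` I" using r by force
  qed
  show "finite (pieces n c P)" by (rule finite_subset[OF sub]) (simp add: I)
  have "card (pieces n c P) \<le> card I" by (rule surj_card_le[OF I(1) sub])
  also note I(2)
  also have "2 * card ?K + 2 * card W \<le> 2 * (m + 1) + 2 * card (itin n ` P)"
    using K W by (intro add_mono mult_left_mono) auto
  finally show "card (pieces n c P) \<le> 2 * (m + 1) + 2 * card (itin n ` P)" .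
  show "spread {r \<in> P. c r = k} (3 * \<sigma>)" for k
  proof -
    have "\<bar>u r - u r'\<bar> \<le> 3 * \<sigma> \<and> \<bar>v r - v r'\<bar> \<le> 3 * \<sigma>" if r: "r \<in> P" "r' \<in> P" "c r = k" "c r' = k" for r r'
    proof -
      have "\<lfloor>u r / \<sigma>\<rfloor> = \<lfloor>u r' / \<sigma>\<rfloor>" using r by (auto simp: c_def)
      then have "\<bar>u r / \<sigma> - u r' / \<sigma>\<bar> \<le> 1" by linarith
      then have u: "\<bar>u r - u r'\<bar> \<le> \<sigma>" using \<sigma> by (simp flip: diff_divide_distrib add: abs_divide)
      have "\<omega> \<le> \<sigma>" using \<rho> \<sigma> mult_left_mono[of \<rho> 4 \<sigma>] by (simp add: \<omega>_def)
      then have hh: "\<bar>h r\<bar> \<le> \<sigma>" "\<bar>h r'\<bar> \<le> \<sigma>" using hP[OF r(1)] hP[OF r(2)] by linarith+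
      have "\<bar>s * (u r - u r')\<bar> \<le> 1 * \<sigma>" unfolding abs_mult using s1 u by (intro mult_mono) auto
      \<comment> \<open>Two heights and one slope term, each at most \<sigma>, give the 3
        \<sigma>.\<close>
      moreover have "v r - v r' = h r - h r' + s * (u r - u r')" by (simp add: h_def algebra_simps)
      ultimately show ?thesis using u hh \<sigma> by linarith
    qed
    then show ?thesis using uv by (auto simp: spread_def)
  qed
qed

end

section \<open>The uniform density bound\<close>

context tent_memory
begin

definition start :: "(real \<times> real) set" where "start = {p. right p} \<inter> sq"

lemma start_props: "convex start" "start \<in> sets borel" "start \<subseteq> U" "1/4 \<le> measure lborel start" "measure lborel start \<le> 1"
proof -
  have "cyl [True] = {p. right p}" by (auto simp: cyl_def)
  then show "convex start"
    using cyl_convex[of "[True]"] unfolding start_def sq_def by (auto intro!: convex_Int convex_Times)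
  show b: "start \<in> sets borel" unfolding start_def by measurable
  show "start \<subseteq> U" using right_U by (auto simp: start_def)
  have sub: "{1/2..1} \<times> {1/2..1} \<subseteq> start"
  proof clarify
    fix x y :: real assume "x \<in> {1/2..1}" "y \<in> {1/2..1}"
    then have "a * (1/2) + (1 - a) * (1/2) \<le> a * y + (1 - a) * x" "(x, y) \<in> sq"
      using a_lo a_hi by (auto intro!: add_mono mult_left_mono simp: sq_def)
    moreover have "a * (1/2) + (1 - a) * (1/2) = 1/2" by (simp add: field_simps)
    ultimately show "(x, y) \<in> start" by (simp only: start_def right_def avg_def Int_iff mem_Collect_eq fst_conv snd_conv simp_thms)
  qed
  have f: "start \<in> fmeasurable lborel" using b by (intro fmeasurable_sq) (auto simp: start_def)
  have "measure lborel ({1/2..1::real} \<times> {1/2..1::real}) \<le> measure lborel start"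
    using sub f by (intro measure_mono_fmeasurable) (auto intro!: borel_closed closed_Times)
  then show "1/4 \<le> measure lborel start" using measure_lborel_square[of "1/2" 1 "1/2" 1] by simp
  have "measure lborel start \<le> measure lborel sq"
    using b by (intro measure_mono_fmeasurable fmeasurable_sq) (auto simp: start_def)
  then show "measure lborel start \<le> 1" using measure_lborel_square[of 0 1 0 1] by (simp add: sq_def)
qed

text \<open>A crude bound, one summand per branch, each inverse branch not increasing area. It
  serves only for the fewer than \<open>n\<close> steps that remain after division by the block
  length in \<open>density_bound\<close>.\<close>

lemma measure_G_vimage:
  assumes A: "A \<in> sets borel"
  shows "measure lborel (G a -` A \<inter> sq) \<le> 2 * measure lborel (A \<inter> sq)"
proof -
  have As: "A \<inter> sq \<in> sets borel" using A by simp
  have m: "measure lborel (Br b -` (A \<inter> sq)) \<le> measure lborel (A \<inter> sq)" for b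
  proof -
    have "d * measure lborel (Br b -` (A \<inter> sq)) = measure lborel (A \<inter> sq)"
    proof -
      have "Brw [b] = Br b" by (rule ext) simp
      then show ?thesis using measure_Brw_vimage[OF As, of "[b]"] by (metis length_Cons list.size(3) power_one_right One_nat_def)
    qed
    moreover have "1 * measure lborel (Br b -` (A \<inter> sq)) \<le> d * measure lborel (Br b -` (A \<inter> sq))"
      using d_bounds by (intro mult_right_mono) auto
    ultimately show ?thesis by simp
  qed
  have Bb: "Br b -` (A \<inter> sq) \<inter> sq \<in> fmeasurable lborel" for b
    using measurable_sets[OF Br_measurable As, of b] by (intro fmeasurable_sq) auto
  have Bf: "Br b -` (A \<inter> sq) \<in> fmeasurable lborel" for b
  proof -
    have L: "Br b = (\<lambda>p. (0 * fst p + 1 * snd p + 0, (if b then -d else d) * fst p + (if b then -2*a else 2*a) * snd p + (if b then 2 else 0)))"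
      by (auto simp: Br_def avg_def d_def algebra_simps)
    have "ennreal d * emeasure lborel (Br b -` (A \<inter> sq)) = emeasure lborel (A \<inter> sq)"
      using emeasure_affine_vimage[OF As, of 0 "if b then -2*a else 2*a" 1 "if b then -d else d" 0 "if b then 2 else 0"] d_bounds
      unfolding L by (cases b) auto
    moreover have "emeasure lborel (A \<inter> sq) < \<infinity>" using fmeasurable_sq[OF As] by (simp add: fmeasurable_def)
    ultimately have "emeasure lborel (Br b -` (A \<inter> sq)) < \<infinity>"
      using d_bounds by (auto simp: ennreal_mult_less_top less_top[symmetric] ennreal_mult_eq_top_iff)
    then show ?thesis using measurable_sets[OF Br_measurable As, of b] by (simp add: fmeasurable_def)
  qed
  have "G a -` A \<inter> sq \<subseteq> Br True -` (A \<inter> sq) \<union> Br False -` (A \<inter> sq)"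
  proof
    fix p assume p: "p \<in> G a -` A \<inter> sq"
    then have "Br (right p) p \<in> A \<inter> sq" using G_sq[of p] by (simp add: G_Br)
    then show "p \<in> Br True -` (A \<inter> sq) \<union> Br False -` (A \<inter> sq)" by (cases "right p") auto
  qed
  moreover have "G a -` A \<inter> sq \<in> sets borel" using measurable_sets[OF G_measurable A] by simp
  ultimately have "measure lborel (G a -` A \<inter> sq) \<le> measure lborel (Br True -` (A \<inter> sq) \<union> Br False -` (A \<inter> sq))"
    using Bf by (intro measure_mono_fmeasurable) auto
  also have "\<dots> \<le> measure lborel (Br True -` (A \<inter> sq)) + measure lborel (Br False -` (A \<inter> sq))"
    by (intro measure_Un_le fmeasurableD Bf)
  finally show ?thesis using m[of True] m[of False] by linarith
qed

lemma measure_Gn_vimage: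
  assumes A: "A \<in> sets borel"
  shows "measure lborel ((G a ^^ n) -` A \<inter> sq) \<le> 2 ^ n * measure lborel (A \<inter> sq)"
proof (induction n)
  case (Suc n)
  have B: "(G a ^^ n) -` A \<in> sets borel" using measurable_sets[OF Gn_measurable A] by simp
  have "(G a ^^ Suc n) -` A = G a -` ((G a ^^ n) -` A)" by (auto simp: funpow_swap1)
  then have "measure lborel ((G a ^^ Suc n) -` A \<inter> sq) \<le> 2 * measure lborel ((G a ^^ n) -` A \<inter> sq)"
    using measure_G_vimage[OF B] by simp
  with Suc show ?case by (simp del: funpow.simps)
qed simp

lemma ex_uniform_lower:
  assumes "finite (S :: real set)" "\<And>x. x \<in> S \<Longrightarrow> 0 < x"
  shows "\<exists>\<rho>>0. \<rho> \<le> 1 \<and> (\<forall>x\<in>S. 2 * \<rho> < x)"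
proof -
  define m where "m = Min (insert 1 S)"
  have "0 < m" "m \<le> 1" "\<And>x. x \<in> S \<Longrightarrow> m \<le> x" using assms by (auto simp: m_def)
  then show ?thesis by (intro exI[of _ "m / 3"]) force
qed

text \<open>Thin sets are cut into at most \<open>d ^ n / 2\<close> pieces by \<open>G ^ n\<close>, while fat sets are paid for by
  their area; iterating gives a geometric series.\<close>
lemma density_bound:
  "\<exists>C. \<forall>n. \<forall>A\<in>sets borel. measure lborel (start \<inter> (G a ^^ n) -` A) \<le> C * measure lborel (A \<inter> sq)"
proof -
  obtain n where n: "2 * (3 * Lam n + 2) + 8 * (33/25) ^ n \<le> d ^ n / 2" using ex_contraction by blast
  have d: "1 \<le> d ^ n" "0 < d ^ n" using d_bounds by auto
  have Lam: "0 < Lam n" using d_bounds by (simp add: Lam_def)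
  have n0: "0 < n"
  proof (rule ccontr)
    assume "\<not> 0 < n"
    then show False using n Lam by simp
  qed
  \<comment> \<open>With \<open>m\<close> at least 3 \<open>Lam n\<close> and \<sigma> = \<delta> /
    m, a piece of spread 3 \<sigma> has an image of spread at most \<delta>, ready for the next
    block; a set of spread \<delta> meets at most m + 1 slices. The size of \<delta> is what
    \<open>card_itin_le\<close> needs for \<open>n\<close> steps.\<close>
  define m where "m = nat \<lceil>3 * Lam n\<rceil>"
  have m: "3 * Lam n \<le> m" "m \<le> 3 * Lam n + 1" "0 < m" using Lam by (auto simp: m_def)
  define \<delta> where "\<delta> = 1/1000 / (2::real) ^ n"
  define \<sigma> where "\<sigma> = \<delta> / m"
  have \<delta>: "0 < \<delta>" "\<delta> * 2 ^ n \<le> 1/1000" by (auto simp: \<delta>_def)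
  have \<sigma>: "0 < \<sigma>" "real m * \<sigma> = \<delta>" using \<delta> m by (auto simp: \<sigma>_def)
  have "3 * Lam n * \<sigma> \<le> real m * \<sigma>" using m(1) \<sigma>(1) by (intro mult_right_mono) auto
  then have e\<sigma>: "Lam n * (3 * \<sigma>) \<le> \<delta>" unfolding \<sigma>(2) by (simp add: mult_ac)
  have "\<delta> \<le> 1/1000 / 1" unfolding \<delta>_def by (intro divide_left_mono) auto
  moreover have "\<sigma> \<le> \<delta>" using mult_right_mono[of 1 "real m" \<sigma>] m \<sigma> by simp
  ultimately have \<sigma>1: "\<sigma> \<le> 1" by simp
  let ?F = "(\<lambda>w. measure lborel (cyl w \<inter> sq)) ` {w. length w = n \<and> 0 < measure lborel (cyl w \<inter> sq)}"
  have finW: "finite {w :: bool list. length w = n}" using finite_lists_length_eq[of "UNIV :: bool set" n] by simp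
  have F: "finite ?F" by (intro finite_imageI finite_subset[OF _ finW]) auto
  have "0 < x" if "x \<in> ?F" for x using that by auto
  from ex_uniform_lower[OF F this] obtain \<rho> where \<rho>: "0 < \<rho>" "\<rho> \<le> 1" and "\<forall>x\<in>?F. 2 * \<rho> < x" by blast
  then have fat: "2 * \<rho> < measure lborel (cyl w \<inter> sq)" if "length w = n" "0 < measure lborel (cyl w \<inter> sq)" for w
    using that by blast
  define \<eta> where "\<eta> = \<sigma>\<^sup>2 * \<rho> / 16"
  have \<eta>: "0 < \<eta>" "\<eta> \<le> 1/4"
  proof -
    show "0 < \<eta>" using \<sigma> \<rho> by (simp add: \<eta>_def)
    have "\<sigma>\<^sup>2 * \<rho> \<le> 1 * 1" using \<sigma> \<sigma>1 \<rho> by (intro mult_mono power_le_one) auto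
    then show "\<eta> \<le> 1/4" unfolding \<eta>_def by linarith
  qed
  define cg where "cg = (\<lambda>p :: real \<times> real. (\<lfloor>fst p / \<sigma>\<rfloor>, \<lfloor>snd p / \<sigma>\<rfloor>))"
  define Bs where "Bs = {w :: bool list. length w = n} \<times> ({0..\<lfloor>1/\<sigma>\<rfloor>} \<times> {0..\<lfloor>1/\<sigma>\<rfloor>})"
  define B where "B = real (card Bs)"
  have finB: "finite Bs" using finW by (simp add: Bs_def)
  \<comment> \<open>A fat set costs at most B x with x = (1/2)^k, and this is at most (\<beta> x /
    2) times its area. These contributions sum to \<beta> (1 - (1/2)^k).\<close>
  define \<beta> where "\<beta> = 2 * B / \<eta>"
  have B0: "0 \<le> B" "0 \<le> \<beta>" using \<eta> by (auto simp: B_def \<beta>_def)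
  \<comment> \<open>Images of pieces always have spread \<delta>. The alternative of area at least
    \<eta> admits the initial set \<open>start\<close>, whose area 1/4 or more exceeds any
    admissible \<eta>.\<close>
  have main: "measure lborel (P \<inter> (G a ^^ (k * n)) -` A) \<le> ((1/2) ^ k + \<beta> * (1 - (1/2) ^ k) * measure lborel P) * measure lborel (A \<inter> sq)"
    if "convex P" "P \<in> sets borel" "P \<subseteq> U" "spread P \<delta> \<or> \<eta> \<le> measure lborel P" "A \<in> sets borel" for P A k
    using that
  proof (induction k arbitrary: P)
    case 0
    have "measure lborel (P \<inter> A) \<le> measure lborel (A \<inter> sq)"
      using 0 U_sq by (intro measure_mono_fmeasurable fmeasurable_sq) auto
    then show ?case by (simp add: vimage_def)
  next
    case (Suc k)
    define E where "E = (G a ^^ (k * n)) -` A"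
    define x where "x = (1/2 :: real) ^ k"
    define y where "y = \<beta> * (1 - x)"
    define L where "L = measure lborel (A \<inter> sq)"
    have x: "0 \<le> x" "x \<le> 1" "0 \<le> y" "0 \<le> L" using B0 by (auto simp: x_def y_def L_def power_le_one)
    have E: "E \<in> sets borel" using measurable_sets[OF Gn_measurable Suc.prems(5)] by (simp add: E_def)
    have hyp: "measure lborel (Q \<inter> E) \<le> (x + y * measure lborel Q) * L"
      if "convex Q" "Q \<in> sets borel" "Q \<subseteq> U" "spread Q \<delta>" for Q
      using Suc.IH[OF that(1-3) _ Suc.prems(5)] that(4) unfolding E_def x_def y_def L_def by blast
    have eq: "(G a ^^ (Suc k * n)) -` A = (G a ^^ n) -` E"
      by (auto simp: E_def funpow_add add.commute[of n])
    have step: "measure lborel (P \<inter> (G a ^^ n) -` E) \<le> (M * x / d ^ n + y * measure lborel P) * L"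
      if "slicing c" "finite (pieces n c P)" "real (card (pieces n c P)) \<le> M" "\<And>k. spread {r \<in> P. c r = k} (3 * \<sigma>)" for c M
      by (rule measure_step[OF Suc.prems(1-3) that e\<sigma> E x(1,3,4) hyp])
    have "measure lborel (P \<inter> (G a ^^ n) -` E) \<le> (x / 2 + (y + \<beta> * x / 2) * measure lborel P) * L"
    proof (cases "\<eta> \<le> measure lborel P")
      case True
      have sub: "pieces n cg P \<subseteq> Bs"
      proof clarify
        fix w i j assume "(w, i, j) \<in> pieces n cg P"
        then obtain r where r: "length w = n" "r \<in> P" "i = \<lfloor>fst r / \<sigma>\<rfloor>" "j = \<lfloor>snd r / \<sigma>\<rfloor>"
          by (auto simp: pieces_def cg_def)
        then have "0 \<le> fst r" "fst r \<le> 1" "0 \<le> snd r" "snd r \<le> 1"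
          using Suc.prems(3) U_sq by (auto simp: sq_def)
        then have "0 \<le> fst r / \<sigma>" "fst r / \<sigma> \<le> 1 / \<sigma>" "0 \<le> snd r / \<sigma>" "snd r / \<sigma> \<le> 1 / \<sigma>"
          using \<sigma> by (auto intro: divide_right_mono)
        then show "(w, i, j) \<in> Bs" using r by (auto simp: Bs_def intro: floor_mono)
      qed
      have sp: "spread {r \<in> P. cg r = k} (3 * \<sigma>)" for k
        unfolding spread_def
      proof (intro ballI)
        fix p q assume "p \<in> {r \<in> P. cg r = k}" "q \<in> {r \<in> P. cg r = k}"
        then have "\<lfloor>fst p / \<sigma>\<rfloor> = \<lfloor>fst q / \<sigma>\<rfloor>" "\<lfloor>snd p / \<sigma>\<rfloor> = \<lfloor>snd q / \<sigma>\<rfloor>" by (auto simp: cg_def)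
        then have "\<bar>fst p / \<sigma> - fst q / \<sigma>\<bar> \<le> 1" "\<bar>snd p / \<sigma> - snd q / \<sigma>\<bar> \<le> 1" by linarith+
        then have "\<bar>fst p - fst q\<bar> \<le> \<sigma>" "\<bar>snd p - snd q\<bar> \<le> \<sigma>"
          using \<sigma> by (simp_all flip: diff_divide_distrib add: abs_divide)
        then show "\<bar>fst p - fst q\<bar> \<le> 3 * \<sigma> \<and> \<bar>snd p - snd q\<bar> \<le> 3 * \<sigma>" using \<sigma> by simp
      qed
      have "measure lborel (P \<inter> (G a ^^ n) -` E) \<le> (B * x / d ^ n + y * measure lborel P) * L"
        using finite_subset[OF sub finB] card_mono[OF finB sub] sp
        by (intro step[where c = cg]) (auto simp: B_def cg_def slicing_floor)
      also have "B * x / d ^ n \<le> B * x" using d B0 x mult_left_mono[of 1 "d ^ n" "B * x"] by (simp add: divide_le_eq)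
      also have "B * x = \<beta> * x / 2 * \<eta>" using \<eta> by (simp add: \<beta>_def)
      also have "\<dots> \<le> \<beta> * x / 2 * measure lborel P" using True B0 x by (intro mult_left_mono) auto
      finally have "measure lborel (P \<inter> (G a ^^ n) -` E) \<le> (\<beta> * x / 2 * measure lborel P + y * measure lborel P) * L"
        using x by (simp add: mult_right_mono)
      also have "\<dots> \<le> (x / 2 + (y + \<beta> * x / 2) * measure lborel P) * L"
        using x by (intro mult_right_mono) (simp_all add: algebra_simps)
      finally show ?thesis .
    next
      case False
      then have sp: "spread P \<delta>" and area: "measure lborel P < \<sigma>\<^sup>2 * \<rho> / 16" using Suc.prems(4) by (auto simp: \<eta>_def)
      have Psq: "P \<subseteq> sq" using Suc.prems(3) U_sq by blast
      have ci: "real (card (itin n ` P)) \<le> 4 * (33/25) ^ n" by (rule card_itin_le[OF Psq sp \<delta>(2)])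
      have "\<exists>c. slicing c \<and> finite (pieces n c P) \<and> real (card (pieces n c P)) \<le> d ^ n / 2 \<and> (\<forall>k. spread {r \<in> P. c r = k} (3 * \<sigma>))"
      proof (cases "\<exists>p\<in>P. \<exists>q\<in>P. \<sigma> \<le> \<bar>fst q - fst p\<bar> \<or> \<sigma> \<le> \<bar>snd q - snd p\<bar>")
        case False
        define c where "c = (\<lambda>p :: real \<times> real. (0 :: int, 0 :: int))"
        have sub: "pieces n c P \<subseteq> (\<lambda>w. (w, 0, 0)) ` itin n ` P"
          by (force simp: pieces_def c_def cyl_def)
        have f: "finite (itin n ` P)" by (rule finite_itin)
        have "card (pieces n c P) \<le> card (itin n ` P)" by (rule surj_card_le[OF f sub])
        then have "real (card (pieces n c P)) \<le> 4 * (33/25) ^ n" using ci by linarith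
        also have "\<dots> \<le> d ^ n / 2"
          using Lam by (intro order_trans[OF _ n] add_increasing) auto
        finally have "real (card (pieces n c P)) \<le> d ^ n / 2" .
        moreover have "finite (pieces n c P)" by (rule finite_subset[OF sub]) (use f in simp)
        moreover have "spread {r \<in> P. c r = k} (3 * \<sigma>)" for k
          unfolding spread_def
        proof (intro ballI)
          fix p q assume "p \<in> {r \<in> P. c r = k}" "q \<in> {r \<in> P. c r = k}"
          then have "\<bar>fst p - fst q\<bar> < \<sigma>" "\<bar>snd p - snd q\<bar> < \<sigma>" using False by (auto simp: not_le)
          then show "\<bar>fst p - fst q\<bar> \<le> 3 * \<sigma> \<and> \<bar>snd p - snd q\<bar> \<le> 3 * \<sigma>" using \<sigma> by simp
        qed
        moreover have "slicing c" unfolding c_def by (rule slicing_floor)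
        ultimately show ?thesis by blast
      next
        case True
        then obtain p q where pq: "p \<in> P" "q \<in> P" "\<sigma> \<le> \<bar>fst q - fst p\<bar> \<or> \<sigma> \<le> \<bar>snd q - snd p\<bar>" by blast
        obtain u v where uv: "(u, v) = (fst, snd) \<or> (u, v) = (snd, fst)"
          and pq': "\<sigma> \<le> \<bar>u q - u p\<bar>" "\<bar>v q - v p\<bar> \<le> \<bar>u q - u p\<bar>"
        proof (cases "\<bar>snd q - snd p\<bar> \<le> \<bar>fst q - fst p\<bar>")
          case True
          then show ?thesis using pq that[of fst snd] by force
        next
          case False
          then show ?thesis using pq that[of snd fst] by force
        qed
        have ext: "\<bar>u p - u q\<bar> \<le> real m * \<sigma>" if "p \<in> P" "q \<in> P" for p q
          using sp that uv unfolding \<sigma>(2) spread_def by auto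
        note t = thin_pieces[OF Suc.prems(1-3) uv pq(1,2) pq' \<sigma>(1) \<rho> area fat ext]
        let ?c = "\<lambda>r. (\<lfloor>u r / \<sigma>\<rfloor>, 0 :: int)"
        have "real (card (pieces n ?c P)) \<le> real (2 * (m + 1) + 2 * card (itin n ` P))"
          unfolding of_nat_le_iff by (rule t(2))
        also have "\<dots> = 2 * (real m + 1) + 2 * real (card (itin n ` P))" by simp
        also have "\<dots> \<le> 2 * (3 * Lam n + 2) + 8 * (33/25) ^ n"
          by (rule add_mono) (use m ci in simp_all)
        also have "\<dots> \<le> d ^ n / 2" by (rule n)
        finally have "real (card (pieces n ?c P)) \<le> d ^ n / 2" .
        moreover have "slicing ?c" using uv slicing_floor by auto
        moreover have "finite (pieces n ?c P)" by (rule t(1))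
        moreover have "\<forall>k. spread {r \<in> P. ?c r = k} (3 * \<sigma>)" using t(3) by blast
        ultimately show ?thesis by blast
      qed
      then obtain c where c: "slicing c" "finite (pieces n c P)" "real (card (pieces n c P)) \<le> d ^ n / 2" "\<And>k. spread {r \<in> P. c r = k} (3 * \<sigma>)"
        by blast
      have "measure lborel (P \<inter> (G a ^^ n) -` E) \<le> (d ^ n / 2 * x / d ^ n + y * measure lborel P) * L"
        by (rule step[OF c])
      also have "d ^ n / 2 * x / d ^ n = x / 2" using d_bounds by simp
      also have "(x / 2 + y * measure lborel P) * L \<le> (x / 2 + (y + \<beta> * x / 2) * measure lborel P) * L"
        using x B0 by (intro mult_right_mono add_mono) auto
      finally show ?thesis .
    qed
    also have "x / 2 = (1/2) ^ Suc k" by (simp add: x_def)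
    also have "y + \<beta> * x / 2 = \<beta> * (1 - (1/2) ^ Suc k)" by (simp add: x_def y_def algebra_simps)
    finally show ?case unfolding eq L_def .
  qed
  \<comment> \<open>The factor \<open>2 ^ n\<close> pays for the \<open>l mod n\<close> steps
    outside complete blocks.\<close>
  define C where "C = (1 + \<beta>) * 2 ^ n"
  have "measure lborel (start \<inter> (G a ^^ l) -` A) \<le> C * measure lborel (A \<inter> sq)" if A: "A \<in> sets borel" for l A
  proof -
    define k j where "k = l div n" and "j = l mod n"
    have l: "l = j + k * n" by (simp add: k_def j_def)
    have jn: "j \<le> n" using n0 by (simp add: j_def less_imp_le)
    let ?E = "(G a ^^ j) -` A"
    have E: "?E \<in> sets borel" using measurable_sets[OF Gn_measurable A] by simp
    have "start \<inter> (G a ^^ l) -` A = start \<inter> (G a ^^ (k * n)) -` ?E" by (auto simp: l funpow_add)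
    then have "measure lborel (start \<inter> (G a ^^ l) -` A)
        \<le> ((1/2) ^ k + \<beta> * (1 - (1/2) ^ k) * measure lborel start) * measure lborel (?E \<inter> sq)"
      using main[OF start_props(1-3) _ E, of k] start_props(4) \<eta> by simp
    also have "\<dots> \<le> (1 + \<beta> * 1 * 1) * measure lborel (?E \<inter> sq)"
      using B0 start_props(5) by (intro mult_right_mono add_mono mult_mono power_le_one) (auto simp: power_le_one)
    also have "\<dots> \<le> (1 + \<beta>) * (2 ^ j * measure lborel (A \<inter> sq))"
      using B0 measure_Gn_vimage[OF A, of j] by (simp add: mult_left_mono)
    also have "\<dots> \<le> (1 + \<beta>) * (2 ^ n * measure lborel (A \<inter> sq))"
      using B0 jn by (intro mult_left_mono mult_right_mono power_increasing) auto
    finally show ?thesis by (simp add: C_def mult.assoc)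
  qed
  then show ?thesis by blast
qed

end

section \<open>The invariant measure\<close>

text \<open>By Tychonoff the Cesaro averages of the push-forwards, as functions on Borel sets, have a cluster
  point; it is finitely additive and invariant, and the density bound makes it countably additive.\<close>
lemma acip_of_bounded_density:
  fixes T :: "real \<times> real \<Rightarrow> real \<times> real"
  assumes T: "T \<in> borel_measurable borel" and S: "S \<in> fmeasurable lborel"
    and P: "P \<in> sets borel" "P \<subseteq> S" "0 < measure lborel P"
    and TS: "\<And>p. p \<in> S \<Longrightarrow> T p \<in> S"
    and bd: "\<And>n A. A \<in> sets borel \<Longrightarrow> measure lborel (P \<inter> (T ^^ n) -` A) \<le> C * measure lborel (A \<inter> S)"
  shows "\<exists>\<mu>. sets \<mu> = sets borel \<and> prob_space \<mu> \<and> emeasure \<mu> S = 1 \<and> absolutely_continuous lborel \<mu> \<and>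
      T \<in> measurable \<mu> \<mu> \<and> (\<forall>A\<in>sets \<mu>. emeasure \<mu> (T -` A \<inter> space \<mu>) = emeasure \<mu> A)"
proof -
  have Tn: "(T ^^ n) \<in> borel_measurable borel" for n
    by (induction n) (auto intro: measurable_compose[OF _ T] simp: id_def comp_def)
  have TA: "T -` A \<in> sets borel" if "A \<in> sets borel" for A using measurable_sets[OF T that] by simp
  have Sb: "S \<in> sets borel" using fmeasurableD[OF S] by simp
  have Pf: "X \<in> fmeasurable lborel" if "X \<in> sets borel" "X \<subseteq> P" for X
    using that P S by (intro fmeasurableI2[OF S]) auto
  have PT: "P \<inter> (T ^^ n) -` A \<in> fmeasurable lborel" if "A \<in> sets borel" for n A
    using measurable_sets[OF Tn that, of n] P by (intro Pf) auto
  have TnS: "(T ^^ n) p \<in> S" if "p \<in> S" for n p using that TS by (induction n) auto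
  define \<nu> where "\<nu> n A = measure lborel (P \<inter> (T ^^ n) -` A) / measure lborel P" for n A
  have \<nu>01: "0 \<le> \<nu> n A" "\<nu> n A \<le> 1" if "A \<in> sets borel" for n A
  proof -
    have "measure lborel (P \<inter> (T ^^ n) -` A) \<le> measure lborel P"
      by (intro measure_mono_fmeasurable Pf fmeasurableD[OF PT[OF that]]) (use P in auto)
    then show "0 \<le> \<nu> n A" "\<nu> n A \<le> 1" using P by (auto simp: \<nu>_def)
  qed
  have \<nu>_add: "\<nu> n (A \<union> B) = \<nu> n A + \<nu> n B" if "A \<in> sets borel" "B \<in> sets borel" "A \<inter> B = {}" for n A B
  proof -
    have eq: "P \<inter> (T ^^ n) -` (A \<union> B) = (P \<inter> (T ^^ n) -` A) \<union> (P \<inter> (T ^^ n) -` B)" by auto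
    have "measure lborel (P \<inter> (T ^^ n) -` (A \<union> B)) = measure lborel (P \<inter> (T ^^ n) -` A) + measure lborel (P \<inter> (T ^^ n) -` B)"
      unfolding eq using that
      by (intro measure_Union fmeasurableD[OF PT]) (auto simp: fmeasurableD2[OF PT])
    then show ?thesis by (simp add: \<nu>_def add_divide_distrib)
  qed
  have \<nu>_S: "\<nu> n S = 1" for n
  proof -
    have "P \<inter> (T ^^ n) -` S = P" using TnS P(2) by auto
    then show ?thesis using P by (simp add: \<nu>_def)
  qed
  have \<nu>_T: "\<nu> n (T -` A) = \<nu> (Suc n) A" for n A by (simp add: \<nu>_def vimage_comp)
  define C' where "C' = C / measure lborel P"
  have \<nu>_bd: "\<nu> n A \<le> C' * measure lborel (A \<inter> S)" if "A \<in> sets borel" for n A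
    using bd[OF that, of n] P by (simp add: \<nu>_def C'_def divide_right_mono)
  \<comment> \<open>The value 0 off the Borel sets makes \<open>\<phi> n\<close> a point of the cube
    of all functions from sets to [0,1], to which compactness applies.\<close>
  define \<phi> where "\<phi> n A = (if A \<in> sets borel then (\<Sum>k<Suc n. \<nu> k A) / Suc n else 0)" for n A
  have \<phi>_le: "\<phi> n A \<le> b" if "A \<in> sets borel" "\<And>k. \<nu> k A \<le> b" for n A b
  proof -
    have "(\<Sum>k<Suc n. \<nu> k A) \<le> of_nat (card {..<Suc n}) * b" using that by (intro sum_bounded_above) auto
    then show ?thesis using that(1) by (simp add: \<phi>_def divide_le_eq mult.commute)
  qed
  have \<phi>01: "0 \<le> \<phi> n A \<and> \<phi> n A \<le> 1" for n A
  proof (cases "A \<in> sets borel")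
    case True
    have "0 \<le> \<phi> n A" using \<nu>01[OF True] by (auto simp: \<phi>_def simp del: sum.lessThan_Suc intro!: sum_nonneg divide_nonneg_nonneg)
    then show ?thesis using \<phi>_le[OF True \<nu>01(2)[OF True]] by simp
  qed (simp add: \<phi>_def)
  have \<phi>_add: "\<phi> n (A \<union> B) = \<phi> n A + \<phi> n B" if "A \<in> sets borel" "B \<in> sets borel" "A \<inter> B = {}" for n A B
    using that by (simp add: \<phi>_def \<nu>_add sum.distrib add_divide_distrib del: sum.lessThan_Suc)
  have \<phi>_S: "\<phi> n S = 1" for n using Sb by (simp add: \<phi>_def \<nu>_S del: sum.lessThan_Suc)
  have \<phi>_T: "(\<lambda>n. \<phi> n (T -` A) - \<phi> n A) \<longlonglongrightarrow> 0" if A: "A \<in> sets borel" for A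
  proof (rule Lim_null_comparison)
    show "\<forall>\<^sub>F n in sequentially. norm (\<phi> n (T -` A) - \<phi> n A) \<le> inverse (real (Suc n))"
    proof (rule always_eventually, rule allI)
      fix n
      have "\<phi> n (T -` A) - \<phi> n A = (\<Sum>k<Suc n. \<nu> (Suc k) A - \<nu> k A) / Suc n"
        using A TA[OF A] by (simp add: \<phi>_def \<nu>_T sum_subtractf diff_divide_distrib del: sum.lessThan_Suc)
      also have "\<dots> = (\<nu> (Suc n) A - \<nu> 0 A) / Suc n" using sum_lessThan_telescope[of "\<lambda>k. \<nu> k A" "Suc n"] by (rule arg_cong)
      finally have "norm (\<phi> n (T -` A) - \<phi> n A) = \<bar>\<nu> (Suc n) A - \<nu> 0 A\<bar> / Suc n" by (simp add: abs_divide)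
      also have "\<dots> \<le> 1 / Suc n" using \<nu>01[OF A, of "Suc n"] \<nu>01[OF A, of 0] by (intro divide_right_mono) auto
      finally show "norm (\<phi> n (T -` A) - \<phi> n A) \<le> inverse (real (Suc n))" by (simp add: divide_inverse)
    qed
  qed (rule LIMSEQ_inverse_real_of_nat)
  have "compactin (product_topology (\<lambda>_ :: (real \<times> real) set. euclidean) UNIV) (PiE UNIV (\<lambda>_. {0..1::real}))"
    unfolding compactin_PiE by simp
  then have comp: "compact (PiE UNIV (\<lambda>_ :: (real \<times> real) set. {0..1::real}))"
    by (simp only: euclidean_product_topology compactin_euclidean_iff)
  define F where "F = filtermap \<phi> sequentially"
  have "F \<noteq> bot" by (simp add: F_def filtermap_bot_iff)
  moreover have "\<forall>\<^sub>F f in F. f \<in> PiE UNIV (\<lambda>_. {0..1})"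
    unfolding F_def eventually_filtermap using \<phi>01 by (intro always_eventually) auto
  ultimately obtain m where m: "inf (nhds m) F \<noteq> bot" using comp unfolding compact_filter by blast
  \<comment> \<open>A cluster point need not be the limit of a subsequence in this product.
    \<open>H\<close> is a filter finer than the tail filter of the averages and converges to
    \<open>m\<close>, so relations holding for all \<open>n\<close>, or in the limit, pass to
    \<open>m\<close>.\<close>
  define H where "H = inf (nhds m) F"
  have H: "H \<noteq> bot" using m by (simp add: H_def)
  have lim: "((\<lambda>f. f A) \<longlongrightarrow> m A) H" for A
  proof -
    have "((\<lambda>f. f) \<longlongrightarrow> m) H" by (rule filterlim_mono[OF filterlim_ident]) (auto simp: H_def)
    then show ?thesis
      by (rule continuous_on_tendsto_compose[OF continuous_on_product_coordinates]) auto
  qed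
  have evH: "\<forall>\<^sub>F f in H. Q f" if "\<And>n. Q (\<phi> n)" for Q
    by (rule filter_leD[of H F]) (auto simp: H_def F_def eventually_filtermap that)
  have m_le: "m A \<le> b" if "\<And>n. \<phi> n A \<le> b" for A b
    by (rule tendsto_upperbound[OF lim evH H]) (rule that)
  have m0: "0 \<le> m A" for A
    by (rule tendsto_lowerbound[OF lim evH H]) (use \<phi>01 in blast)
  have m_add: "m (A \<union> B) = m A + m B" if "A \<in> sets borel" "B \<in> sets borel" "A \<inter> B = {}" for A B
  proof (rule tendsto_unique[OF H])
    show "((\<lambda>f. f (A \<union> B)) \<longlongrightarrow> m A + m B) H"
      using tendsto_add[OF lim[of A] lim[of B]]
      by (rule Lim_transform_eventually) (rule evH, simp add: \<phi>_add that)
  qed (rule lim)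
  have m_S: "m S = 1"
  proof (rule tendsto_unique[OF H lim])
    show "((\<lambda>f. f S) \<longlongrightarrow> 1) H"
      by (rule Lim_transform_eventually[OF tendsto_const]) (rule evH, simp add: \<phi>_S)
  qed
  have m_T: "m (T -` A) = m A" if A: "A \<in> sets borel" for A
  proof -
    have "((\<lambda>f. f (T -` A) - f A) \<longlongrightarrow> 0) F"
      unfolding F_def filterlim_filtermap by (rule \<phi>_T[OF A])
    then have "((\<lambda>f. f (T -` A) - f A) \<longlongrightarrow> 0) H" by (rule tendsto_mono[rotated]) (simp add: H_def)
    moreover have "((\<lambda>f. f (T -` A) - f A) \<longlongrightarrow> m (T -` A) - m A) H" by (intro tendsto_diff lim)
    ultimately have "m (T -` A) - m A = 0" using tendsto_unique[OF H] by blast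
    then show ?thesis by simp
  qed
  have m_bd: "m A \<le> C' * measure lborel (A \<inter> S)" if "A \<in> sets borel" for A
    by (intro m_le \<phi>_le that \<nu>_bd)
  have m_empty: "m {} = 0" using m_bd[of "{}"] m0[of "{}"] by simp
  define \<mu> where "\<mu> = measure_of UNIV (sets borel) (\<lambda>A. ennreal (m A))"
  have pos: "positive (sets borel) (\<lambda>A. ennreal (m A))" by (simp add: positive_def m_empty)
  have ca: "countably_additive (sets borel) (\<lambda>A. ennreal (m A))"
  proof (rule sets.empty_continuous_imp_countably_additive[OF pos])
    show "additive (sets borel) (\<lambda>A. ennreal (m A))"
      by (auto simp: additive_def m_add m0 simp flip: ennreal_plus)
    show "\<forall>A\<in>sets borel. ennreal (m A) \<noteq> \<infinity>" by simp
    \<comment> \<open>Continuity at the empty set follows from Lebesgue measure on \<open>S\<close>,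
      which dominates \<open>m\<close> up to the factor \<open>C'\<close>.\<close>
    fix A :: "nat \<Rightarrow> (real \<times> real) set" assume A: "range A \<subseteq> sets borel" "decseq A" "(\<Inter>i. A i) = {}"
    have AS: "A i \<inter> S \<in> fmeasurable lborel" for i using A(1) S Sb by (intro fmeasurableI2[OF S]) auto
    have "(\<lambda>i. measure lborel (A i \<inter> S)) \<longlonglongrightarrow> measure lborel (\<Inter>i. A i \<inter> S)"
    proof (rule Lim_measure_decseq)
      show "range (\<lambda>i. A i \<inter> S) \<subseteq> sets lborel" using fmeasurableD[OF AS] by blast
      show "decseq (\<lambda>i. A i \<inter> S)" using A(2) by (auto simp: decseq_def)
      show "emeasure lborel (A i \<inter> S) \<noteq> \<infinity>" for i using fmeasurableD2[OF AS] by simp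
    qed
    moreover have "(\<Inter>i. A i \<inter> S) = {}" using A(3) by auto
    ultimately have "(\<lambda>i. C' * measure lborel (A i \<inter> S)) \<longlonglongrightarrow> C' * 0" by (intro tendsto_mult tendsto_const) simp
    then have lim0: "(\<lambda>i. C' * measure lborel (A i \<inter> S)) \<longlonglongrightarrow> 0" by simp
    have "norm (m (A i)) \<le> C' * measure lborel (A i \<inter> S)" for i
      using m_bd[of "A i"] m0[of "A i"] A(1) by auto
    then have "(\<lambda>i. m (A i)) \<longlonglongrightarrow> 0"
      by (intro Lim_null_comparison[OF _ lim0] always_eventually allI)
    then show "(\<lambda>i. ennreal (m (A i))) \<longlonglongrightarrow> 0" by (simp flip: ennreal_0 add: m0)
  qed
  have sa: "sigma_algebra UNIV (sets (borel :: (real \<times> real) measure))" using sets.sigma_algebra_axioms[of "borel :: (real \<times> real) measure"] by simp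
  have sets: "sets \<mu> = sets borel" unfolding \<mu>_def using sigma_algebra.sets_measure_of_eq[OF sa] by simp
  have space: "space \<mu> = UNIV" unfolding \<mu>_def by (simp add: space_measure_of_conv)
  have em: "emeasure \<mu> A = ennreal (m A)" if "A \<in> sets borel" for A
    unfolding \<mu>_def by (rule emeasure_measure_of_sigma[OF sa pos ca that])
  have Tm: "T \<in> measurable \<mu> \<mu>" using T by (simp add: measurable_cong_sets[OF sets sets])
  have eS: "emeasure \<mu> S = 1" using em[OF Sb] m_S by simp
  have "m UNIV \<le> 1" by (rule m_le) (use \<phi>01 in blast)
  moreover have "m UNIV = m S + m (- S)" using m_add[of S "- S"] Sb by simp
  ultimately have "m UNIV = 1" using m_S m0[of "- S"] by simp
  then have "prob_space \<mu>" by (intro prob_spaceI) (simp add: space em)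
  moreover have "absolutely_continuous lborel \<mu>"
    unfolding absolutely_continuous_def
  proof
    fix N :: "(real \<times> real) set" assume N: "N \<in> null_sets lborel"
    then have Nb: "N \<in> sets borel" by auto
    have "N \<inter> S \<in> null_sets lborel" using N Sb by (intro null_set_Int2) auto
    then have "measure lborel (N \<inter> S) = 0" by (simp add: measure_def null_sets_def)
    then have "m N = 0" using m_bd[OF Nb] m0[of N] by simp
    then show "N \<in> null_sets \<mu>" using em[OF Nb] Nb sets by (simp add: null_sets_def)
  qed
  moreover have "\<forall>A\<in>sets \<mu>. emeasure \<mu> (T -` A \<inter> space \<mu>) = emeasure \<mu> A"
    using em TA m_T by (simp add: space sets)
  ultimately show ?thesis using sets eS Tm by blast
qed

section \<open>The constant \<open>alpha2\<close> and the conclusion\<close>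

lemma alpha2_poly_strict_mono:
  fixes s t :: real
  assumes "0 \<le> s" "s < t"
  shows "8 * s^4 - 8 * s^3 + 8 * s\<^sup>2 < 8 * t^4 - 8 * t^3 + 8 * t\<^sup>2"
proof (rule DERIV_pos_imp_increasing_open[OF assms(2)])
  fix x assume x: "s < x" "x < t"
  have D: "((\<lambda>x. 8 * x^4 - 8 * x^3 + 8 * x\<^sup>2) has_real_derivative 32 * x^3 - 24 * x\<^sup>2 + 16 * x) (at x)"
    by (auto intro!: derivative_eq_intros simp: eval_nat_numeral)
  \<comment> \<open>Completing the square in the quadratic factor shows that the derivative is
    positive for x > 0.\<close>
  have "32 * x^3 - 24 * x\<^sup>2 + 16 * x = x * ((4 * x - 3/2)\<^sup>2 * 2 + 23/2)"
    by (simp add: power2_eq_square power3_eq_cube algebra_simps)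
  also have "0 < \<dots>" using x assms(1) by (intro mult_pos_pos add_nonneg_pos) auto
  finally show "\<exists>y. ((\<lambda>x. 8 * x^4 - 8 * x^3 + 8 * x\<^sup>2) has_real_derivative y) (at x) \<and> 0 < y"
    by (intro exI[of _ "32 * x^3 - 24 * x\<^sup>2 + 16 * x"] conjI D)
qed (intro continuous_intros)

text \<open>Strict monotonicity makes the root unique, so the description \<open>THE\<close> denotes
  it. The rational lower bound is the left end of the parameter interval on which the quadratic
  forms were checked.\<close>

lemma alpha2_props: "279/1000 \<le> alpha2" "8 * alpha2^4 - 8 * alpha2^3 + 8 * alpha2\<^sup>2 = 1/2"
proof -
  let ?p = "\<lambda>x :: real. 8 * x^4 - 8 * x^3 + 8 * x\<^sup>2"
  have low: "?p (279/1000) < 1/2" by (simp add: power_divide eval_nat_numeral)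
  have "\<exists>x\<ge>0. x \<le> 1 \<and> ?p x = 1/2"
    by (rule IVT') (auto intro!: continuous_intros)
  then obtain x where x: "0 \<le> x" "x \<le> 1" "?p x = 1/2" by blast
  have "alpha2 = x"
    unfolding alpha2_def
  proof (rule the_equality)
    fix y assume y: "0 \<le> y \<and> y \<le> 1 \<and> ?p y = 1/2"
    then show "y = x" using alpha2_poly_strict_mono[of x y] alpha2_poly_strict_mono[of y x] x
      by (cases x y rule: linorder_cases) auto
  qed (use x in simp)
  moreover have "279/1000 \<le> x"
    using alpha2_poly_strict_mono[of x "279/1000"] x low by (cases "x < 279/1000") auto
  ultimately show "279/1000 \<le> alpha2" "?p alpha2 = 1/2" using x by auto
qed

theorem theorem3:
  fixes \<alpha> :: real
  assumes "alpha2 \<le> \<alpha>" and "\<alpha> \<le> 1/3"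
  shows "has_acip (G \<alpha>)"
proof -
  have "8 * alpha2^4 - 8 * alpha2^3 + 8 * alpha2\<^sup>2 \<le> 8 * \<alpha>^4 - 8 * \<alpha>^3 + 8 * \<alpha>\<^sup>2"
    using alpha2_poly_strict_mono[of alpha2 \<alpha>] alpha2_props(1) assms(1) by (cases "alpha2 = \<alpha>") auto
  then interpret tent_memory \<alpha>
    using alpha2_props assms by unfold_locales auto
  obtain C where C: "\<And>n A. A \<in> sets borel \<Longrightarrow> measure lborel (start \<inter> (G \<alpha> ^^ n) -` A) \<le> C * measure lborel (A \<inter> sq)"
    using density_bound by blast
  have "0 < measure lborel start" using start_props(4) by simp
  from acip_of_bounded_density[OF G_measurable fmeasurable_sq[OF sq_borel order_refl] start_props(2) _ this G_sq C]
  show ?thesis unfolding has_acip_def sq_def[symmetric] by (simp add: start_def)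
qed

end
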